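(* Let $k$ be a field and let $I = (xy, xz, yz) \subseteq k[x,y,z]$. Then for every integer $n\ge 1$, $$\operatorname{sdef}_I(n) = \begin{cases} \frac32 n - 2 & \text{if } n \equiv 0 \pmod 2,\\ \frac32 n - \frac32 & \text{if } n\equiv 1 \pmod 2.\end{cases}$$
   Context: Let $R=k[x,y,z]$ and $\mathfrak m=(x,y,z)$. For an ideal $I$ of $R$, $I^{(n)} := \bigcap_{\mathfrak p \in \operatorname{Ass}(R/I)} (I^n R_{\mathfrak p} \cap R)$ is the $n$-th symbolic power, and $\operatorname{sdef}_I(n) := \mu(I^{(n)}/I^n)$, where $\mu(M)=\dim_k(M/\mathfrak m M)$ is the minimal number of generators of a finitely generated graded module $M$. *)

theory Defs
  imports
    "HOL-Library.Poly_Mapping"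
    "HOL-Library.Numeral_Type"
    "HOL-Computational_Algebra.Fraction_Field"
    "HOL-Algebra.Ideal_Product"
    "HOL-Algebra.QuotRing"
    "HOL-Algebra.Algebraic_Closure_Type"
    "Jordan_Normal_Form.Missing_VectorSpace"
begin

section \<open>Modules\<close>

definition ideal_module :: "('a, 'b) ring_scheme \<Rightarrow> 'a set \<Rightarrow> ('a, 'a) module" where
  "ideal_module R J =
    \<lparr>carrier = J, monoid.mult = (\<otimes>\<^bsub>R\<^esub>), one = \<one>\<^bsub>R\<^esub>, ring.zero = \<zero>\<^bsub>R\<^esub>, add = (\<oplus>\<^bsub>R\<^esub>),
     module.smult = (\<otimes>\<^bsub>R\<^esub>)\<rparr>"

text \<open>
  The module structure on \<open>M / N\<close>, in the style of \<^const>\<open>FactRing\<close>. The fields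
  \<open>mult\<close> and \<open>one\<close> are only present because module records extend ring records.
\<close>

definition module_quot :: "('a, 'b, 'c) module_scheme \<Rightarrow> 'b set \<Rightarrow> ('a, 'b set) module" where
  "module_quot M N =
    \<lparr>carrier = a_rcosets\<^bsub>M\<^esub> N, monoid.mult = rcoset_mult M N, one = N +>\<^bsub>M\<^esub> \<one>\<^bsub>M\<^esub>,
     ring.zero = N, add = set_add M, module.smult = (\<lambda>r A. \<Union>x\<in>A. N +>\<^bsub>M\<^esub> (r \<odot>\<^bsub>M\<^esub> x))\<rparr>"

definition restrict_scalars ::
    "('k \<Rightarrow> 'a) \<Rightarrow> ('a, 'b, 'c) module_scheme \<Rightarrow> ('k, 'b) module" where
  "restrict_scalars \<phi> M =
    \<lparr>carrier = carrier M, monoid.mult = (\<otimes>\<^bsub>M\<^esub>), one = \<one>\<^bsub>M\<^esub>, ring.zero = \<zero>\<^bsub>M\<^esub>, add = (\<oplus>\<^bsub>M\<^esub>),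
     module.smult = (\<lambda>c x. \<phi> c \<odot>\<^bsub>M\<^esub> x)\<rparr>"

definition ideal_smult ::
    "('a, 'd) ring_scheme \<Rightarrow> 'a set \<Rightarrow> ('a, 'b, 'c) module_scheme \<Rightarrow> 'b set" where
  "ideal_smult R J M =
    LinearCombinations.module.span R M {a \<odot>\<^bsub>M\<^esub> x | a x. a \<in> J \<and> x \<in> carrier M}"

definition associated_primes ::
    "('a, 'd) ring_scheme \<Rightarrow> ('a, 'b, 'c) module_scheme \<Rightarrow> 'a set set" where
  "associated_primes R M =
    {P. primeideal P R \<and>
        (\<exists>x\<in>carrier M. P = {r \<in> carrier R. r \<odot>\<^bsub>M\<^esub> x = \<zero>\<^bsub>M\<^esub>})}"

section \<open>Symbolic powers of ideals of an integral domain\<close>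

text \<open>
  For an integral domain, the localization at a prime \<open>P\<close> is realised as a subring of the
  fraction field; the canonical map into it is \<open>\<lambda>a. Fraction_Field.Fract a 1\<close>.
\<close>

definition localization_at :: "'a::idom set \<Rightarrow> 'a fract ring" where
  "localization_at P = ring_of_type_algebra\<lparr>carrier := {Fraction_Field.Fract a s | a s. s \<notin> P}\<rparr>"

definition extended_ideal :: "'a::idom set \<Rightarrow> 'a set \<Rightarrow> 'a fract set" where
  "extended_ideal P J = Idl\<^bsub>localization_at P\<^esub> ((\<lambda>a. Fraction_Field.Fract a 1) ` J)"

definition ideal_power :: "'a::comm_ring_1 set \<Rightarrow> nat \<Rightarrow> 'a set" where
  "ideal_power I n = I [^]\<^bsub>ideals_set ring_of_type_algebra\<^esub> n"

definition symbolic_power :: "'a::idom set \<Rightarrow> nat \<Rightarrow> 'a set" where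
  "symbolic_power I n =
    (let R = ring_of_type_algebra in
      \<Inter>P \<in> associated_primes R (module_quot (ideal_module R (carrier R)) I).
        {f \<in> carrier R. Fraction_Field.Fract f 1 \<in> extended_ideal P (ideal_power I n)})"

section \<open>The polynomial ring in three variables\<close>

text \<open>
  A polynomial maps exponent vectors, indexed by the three-element type \<open>3\<close>, to coefficients.
  The elements of that type are \<open>1\<close>, \<open>2\<close> and \<open>3 = 0\<close>.
\<close>

type_synonym 'k poly3 = "(3 \<Rightarrow>\<^sub>0 nat) \<Rightarrow>\<^sub>0 'k"

abbreviation poly3_ring :: "'k::field poly3 ring" where
  "poly3_ring \<equiv> ring_of_type_algebra"

definition poly3_const :: "'k::field \<Rightarrow> 'k poly3" where
  "poly3_const c = Poly_Mapping.single 0 c"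

definition poly3_var :: "3 \<Rightarrow> 'k::field poly3" where
  "poly3_var i = Poly_Mapping.single (Poly_Mapping.single i 1) 1"

abbreviation x_var :: "'k::field poly3" where "x_var \<equiv> poly3_var 1"
abbreviation y_var :: "'k::field poly3" where "y_var \<equiv> poly3_var 2"
abbreviation z_var :: "'k::field poly3" where "z_var \<equiv> poly3_var 3"

definition irrelevant_ideal :: "'k::field poly3 set" where
  "irrelevant_ideal = Idl\<^bsub>poly3_ring\<^esub> {x_var, y_var, z_var}"

definition min_gens :: "('k::field poly3, 'b, 'c) module_scheme \<Rightarrow> nat" where
  "min_gens M =
    VectorSpace.vectorspace.dim (ring_of_type_algebra :: 'k ring)
      (restrict_scalars poly3_const
        (module_quot M (ideal_smult poly3_ring irrelevant_ideal M)))"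

definition sdef :: "'k::field poly3 set \<Rightarrow> nat \<Rightarrow> nat" where
  "sdef I n =
    min_gens (module_quot (ideal_module poly3_ring (symbolic_power I n)) (ideal_power I n))"

end

theory Submission
  imports Defs
begin

text \<open>
  Both powers are spanned by monomials. For an exponent \<open>e\<close> let \<open>coweight k e\<close> be the sum of the
  two exponents other than the one with index \<open>k\<close>. The ideal \<open>I = (xy, xz, yz)\<close> is the intersection of
  the three primes generated by two variables, and the prime belonging to \<open>k\<close> consists of the polynomials
  of positive \<open>coweight k\<close>. The proof determines the two powers by their exponents: \<open>e\<close> belongs to the
  symbolic power iff all three coweights are at least \<open>n\<close> (\<open>symbolic_power_eq\<close>), and to the ordinary power
  iff in addition the total degree is at least \<open>2 * n\<close> (\<open>ideal_power_eq\<close>). For the symbolic power, the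
  ideal of polynomials with \<open>coweight k\<close> at least \<open>n\<close> is primary to the prime belonging to \<open>k\<close>, because
  weights are additive and the polynomial ring is a domain (\<open>mult_in_weight_ideal_cancel\<close>); and an
  associated prime misses some variable, whose \<open>n\<close>-th power lifts the total degree to at
  least \<open>2 * n\<close>.

  For monomial ideals the minimal generators of a quotient are the minimal monomials of the
  numerator that are not in the denominator (\<open>min_gens_monomial_quotient\<close>). The minimal monomials of
  the symbolic power with total degree below \<open>2 * n\<close> have the exponents \<open>(a, n - a, n - a)\<close>
  with \<open>1 \<le> a\<close> and \<open>2 * a \<le> n\<close> and their permutations (\<open>tight_triple_iff\<close>). There are three permutations
  for each \<open>a\<close> with \<open>2 * a < n\<close>, and only one if \<open>2 * a = n\<close>, which gives \<open>3 * (n - 1) / 2\<close> generators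
  for odd \<open>n\<close> and \<open>3 * (n / 2 - 1) + 1\<close> for even \<open>n\<close>.
\<close>

section \<open>Quotient modules\<close>

lemma module_quot_simps [simp]:
  "carrier (module_quot M N) = a_rcosets\<^bsub>M\<^esub> N"
  "\<zero>\<^bsub>module_quot M N\<^esub> = N"
  "add (module_quot M N) = set_add M"
  "module.smult (module_quot M N) = (\<lambda>r A. \<Union>x\<in>A. N +>\<^bsub>M\<^esub> (r \<odot>\<^bsub>M\<^esub> x))"
  by (simp_all add: module_quot_def)

lemma restrict_scalars_simps [simp]:
  "carrier (restrict_scalars \<phi> M) = carrier M"
  "\<zero>\<^bsub>restrict_scalars \<phi> M\<^esub> = \<zero>\<^bsub>M\<^esub>"
  "add (restrict_scalars \<phi> M) = add M"
  "module.smult (restrict_scalars \<phi> M) = (\<lambda>c x. \<phi> c \<odot>\<^bsub>M\<^esub> x)"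
  by (simp_all add: restrict_scalars_def)

lemma ideal_module_simps [simp]:
  "carrier (ideal_module R J) = J"
  "\<zero>\<^bsub>ideal_module R J\<^esub> = \<zero>\<^bsub>R\<^esub>"
  "add (ideal_module R J) = add R"
  "module.smult (ideal_module R J) = monoid.mult R"
  by (simp_all add: ideal_module_def)

lemma (in module) submodule_imp_abelian_subgroup:
  assumes "LinearCombinations.submodule R N M"
  shows "abelian_subgroup N M"
proof (rule abelian_subgroupI3)
  interpret N: LinearCombinations.submodule R N M by (rule assms)
  show "additive_subgroup N M"
  proof (rule additive_subgroupI, rule M.add.subgroupI)
    show "N \<subseteq> carrier M" by (rule N.subset)
    show "N \<noteq> {}" using N.zero_closed by blast
    fix a assume a: "a \<in> N"
    show "\<ominus>\<^bsub>M\<^esub> a \<in> N"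
    proof -
      have "a \<in> carrier M" using a N.subset by auto
      moreover have "(\<ominus>\<^bsub>R\<^esub> \<one>\<^bsub>R\<^esub>) \<odot>\<^bsub>M\<^esub> a \<in> N" using a by auto
      ultimately show ?thesis by (metis smult_minus_1)
    qed
  qed auto
qed (rule M.abelian_group_axioms)

lemma (in module) coset_eq_iff:
  assumes "LinearCombinations.submodule R N M" "x \<in> carrier M" "y \<in> carrier M"
  shows "N +>\<^bsub>M\<^esub> x = N +>\<^bsub>M\<^esub> y \<longleftrightarrow> (\<exists>h\<in>N. x = h \<oplus>\<^bsub>M\<^esub> y)"
proof -
  interpret N: abelian_subgroup N M
    by (rule submodule_imp_abelian_subgroup[OF assms(1)])
  have "x \<in> N +>\<^bsub>M\<^esub> y \<longleftrightarrow> (\<exists>h\<in>N. x = h \<oplus>\<^bsub>M\<^esub> y)"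
    by (auto simp: a_r_coset_def')
  moreover have "N +>\<^bsub>M\<^esub> x = N +>\<^bsub>M\<^esub> y \<longleftrightarrow> x \<in> N +>\<^bsub>M\<^esub> y"
    using N.a_repr_independence' N.a_repr_independenceD assms(2,3) by metis
  ultimately show ?thesis by simp
qed

lemma (in module) coset_eq_self_iff:
  assumes "LinearCombinations.submodule R N M" "x \<in> carrier M"
  shows "N +>\<^bsub>M\<^esub> x = N \<longleftrightarrow> x \<in> N"
proof -
  interpret N: LinearCombinations.submodule R N M by (rule assms)
  have "N +>\<^bsub>M\<^esub> \<zero>\<^bsub>M\<^esub> = N"
    using M.a_coset_add_zero[OF N.subset] .
  then show ?thesis
    using coset_eq_iff[OF assms M.zero_closed] N.subset by (auto simp: subset_iff)
qed

lemma (in module) carrier_module_quot: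
  "a_rcosets\<^bsub>M\<^esub> N = (\<lambda>x. N +>\<^bsub>M\<^esub> x) ` carrier M"
  by (auto simp: A_RCOSETS_def')

lemma (in module) add_cosets:
  assumes "LinearCombinations.submodule R N M" "x \<in> carrier M" "y \<in> carrier M"
  shows "(N +>\<^bsub>M\<^esub> x) <+>\<^bsub>M\<^esub> (N +>\<^bsub>M\<^esub> y) = N +>\<^bsub>M\<^esub> (x \<oplus>\<^bsub>M\<^esub> y)"
proof -
  interpret N: abelian_subgroup N M
    by (rule submodule_imp_abelian_subgroup[OF assms(1)])
  show ?thesis using N.a_rcos_sum assms(2,3) by simp
qed

lemma (in module) smult_coset:
  assumes "LinearCombinations.submodule R N M" "r \<in> carrier R" "x \<in> carrier M"
  shows "(\<Union>y\<in>N +>\<^bsub>M\<^esub> x. N +>\<^bsub>M\<^esub> (r \<odot>\<^bsub>M\<^esub> y)) = N +>\<^bsub>M\<^esub> (r \<odot>\<^bsub>M\<^esub> x)"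
proof -
  interpret N: LinearCombinations.submodule R N M by (rule assms)
  interpret A: abelian_subgroup N M
    by (rule submodule_imp_abelian_subgroup[OF assms(1)])
  have "N +>\<^bsub>M\<^esub> (r \<odot>\<^bsub>M\<^esub> y) = N +>\<^bsub>M\<^esub> (r \<odot>\<^bsub>M\<^esub> x)" if y: "y \<in> N +>\<^bsub>M\<^esub> x" for y
  proof -
    obtain h where h: "h \<in> N" "y = h \<oplus>\<^bsub>M\<^esub> x"
      using y unfolding a_r_coset_def' by auto
    moreover from h have "h \<in> carrier M" using N.subset by auto
    ultimately have "r \<odot>\<^bsub>M\<^esub> y = r \<odot>\<^bsub>M\<^esub> h \<oplus>\<^bsub>M\<^esub> r \<odot>\<^bsub>M\<^esub> x" "y \<in> carrier M"
      using assms by (auto simp: smult_r_distr)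
    then show ?thesis
      using h assms by (subst coset_eq_iff) auto
  qed
  moreover have "x \<in> N +>\<^bsub>M\<^esub> x" by (rule A.a_rcos_self[OF assms(3)])
  ultimately show ?thesis by blast
qed

lemma (in module) module_module_quot:
  assumes "LinearCombinations.submodule R N M"
  shows "module R (module_quot M N)"
proof -
  interpret N: LinearCombinations.submodule R N M by (rule assms)
  let ?p = "\<lambda>x. N +>\<^bsub>M\<^esub> x"
  define sm where "sm r A = (\<Union>y\<in>A. N +>\<^bsub>M\<^esub> (r \<odot>\<^bsub>M\<^esub> y))" for r A
  have smult: "module.smult (module_quot M N) = sm" by (simp add: fun_eq_iff sm_def)
  have sm: "sm r (?p x) = ?p (r \<odot>\<^bsub>M\<^esub> x)" if "r \<in> carrier R" "x \<in> carrier M" for r x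
    using smult_coset[OF assms that] by (simp add: sm_def)
  note [simp] = add_cosets[OF assms] sm
  have zero: "N = ?p \<zero>\<^bsub>M\<^esub>"
    using M.a_coset_add_zero[OF N.subset] by simp
  have neg: "\<exists>y\<in>carrier M. ?p (x \<oplus>\<^bsub>M\<^esub> y) = N" if "x \<in> carrier M" for x
    using that zero by (intro bexI[of _ "\<ominus>\<^bsub>M\<^esub> x"]) (simp_all add: M.r_neg)
  have addz: "?p x <+>\<^bsub>M\<^esub> N = ?p x" if "x \<in> carrier M" for x
    using that by (subst (2) zero) simp
  show ?thesis
  proof (rule module_criteria)
    show "cring R" by (rule R.is_cring)
    show "\<zero>\<^bsub>module_quot M N\<^esub> \<in> carrier (module_quot M N)"
      using zero by (auto simp: carrier_module_quot)
  qed (unfold smult, auto simp: carrier_module_quot neg addz smult_l_distr smult_r_distr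
        smult_assoc1 M.a_ac)
qed

text \<open>
  Cosets are sets, so a map on \<open>M / N\<close> has to be defined by choosing representatives. This lemma
  does so once; it is used for both of the nested quotients that occur in the number of generators.
\<close>

lemma (in module) factor_through_quot:
  assumes "LinearCombinations.submodule R N M"
    and "\<And>h x. h \<in> N \<Longrightarrow> x \<in> carrier M \<Longrightarrow> c (h \<oplus>\<^bsub>M\<^esub> x) = c x"
  obtains c' where "\<And>x. x \<in> carrier M \<Longrightarrow> c' (N +>\<^bsub>M\<^esub> x) = c x"
proof (rule that)
  fix x assume x: "x \<in> carrier M"
  define y where "y = (SOME y. y \<in> carrier M \<and> N +>\<^bsub>M\<^esub> x = N +>\<^bsub>M\<^esub> y)"
  have y: "y \<in> carrier M \<and> N +>\<^bsub>M\<^esub> x = N +>\<^bsub>M\<^esub> y"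
    unfolding y_def by (rule someI[of _ x]) (simp add: x)
  then obtain h where "h \<in> N" "x = h \<oplus>\<^bsub>M\<^esub> y"
    using coset_eq_iff[OF assms(1) x] by blast
  then have "c x = c y" using assms(2) y by blast
  then show "(\<lambda>A. c (SOME y. y \<in> carrier M \<and> A = N +>\<^bsub>M\<^esub> y)) (N +>\<^bsub>M\<^esub> x) = c x"
    by (simp add: y_def)
qed

section \<open>Dimension from coordinate functionals\<close>

text \<open>
  The family \<open>e\<close> is a basis because \<open>c\<close> is dual to it: applying the functionals to a linear
  combination of the \<open>e b\<close> recovers its coefficients, and \<open>v - (\<Sum>b. c v b \<odot> e b)\<close> is killed by
  all functionals, hence zero. In this form the dimension of a quotient is obtained by computing with
  representatives.
\<close>

lemma (in vectorspace) dim_eq_card_coordinates: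
  assumes fin: "finite B"
    and e: "\<And>b. b \<in> B \<Longrightarrow> e b \<in> carrier V"
    and c: "\<And>v b. v \<in> carrier V \<Longrightarrow> b \<in> B \<Longrightarrow> c v b \<in> carrier K"
    and c_add: "\<And>v w b. v \<in> carrier V \<Longrightarrow> w \<in> carrier V \<Longrightarrow> b \<in> B
        \<Longrightarrow> c (v \<oplus>\<^bsub>V\<^esub> w) b = c v b \<oplus>\<^bsub>K\<^esub> c w b"
    and c_smult: "\<And>a v b. a \<in> carrier K \<Longrightarrow> v \<in> carrier V \<Longrightarrow> b \<in> B
        \<Longrightarrow> c (a \<odot>\<^bsub>V\<^esub> v) b = a \<otimes>\<^bsub>K\<^esub> c v b"
    and dual: "\<And>b b'. b \<in> B \<Longrightarrow> b' \<in> B \<Longrightarrow> c (e b) b' = (if b = b' then \<one>\<^bsub>K\<^esub> else \<zero>\<^bsub>K\<^esub>)"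
    and sep: "\<And>v. v \<in> carrier V \<Longrightarrow> (\<And>b. b \<in> B \<Longrightarrow> c v b = \<zero>\<^bsub>K\<^esub>) \<Longrightarrow> v = \<zero>\<^bsub>V\<^esub>"
  shows "dim = card B"
proof -
  have inj: "inj_on e B"
    using dual by (intro inj_onI) (metis zero_not_one)
  have eC: "e ` B \<subseteq> carrier V" using e by auto
  have c0: "c \<zero>\<^bsub>V\<^esub> b = \<zero>\<^bsub>K\<^esub>" if "b \<in> B" for b
    using c_smult[of "\<zero>\<^bsub>K\<^esub>" "\<zero>\<^bsub>V\<^esub>" b] that c[of "\<zero>\<^bsub>V\<^esub>" b] by simp
  have finsum: "c (\<Oplus>\<^bsub>V\<^esub>w\<in>A. a w \<odot>\<^bsub>V\<^esub> w) b = (\<Oplus>\<^bsub>K\<^esub>w\<in>A. a w \<otimes>\<^bsub>K\<^esub> c w b)"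
    if "finite A" "A \<subseteq> carrier V" "a \<in> A \<rightarrow> carrier K" "b \<in> B" for A a b
    using that
  proof (induction A)
    case empty
    then show ?case by (simp add: c0)
  next
    case (insert w A)
    then show ?case by (simp add: Pi_iff subset_iff c_add c_smult c)
  qed
  have coord: "c (lincomb a (e ` B)) b = a (e b)"
    if "a \<in> e ` B \<rightarrow> carrier K" "b \<in> B" for a b
  proof -
    have "c (lincomb a (e ` B)) b = (\<Oplus>\<^bsub>K\<^esub>w\<in>e ` B. a w \<otimes>\<^bsub>K\<^esub> c w b)"
      unfolding lincomb_def using that fin eC by (intro finsum) auto
    also have "\<dots> = (\<Oplus>\<^bsub>K\<^esub>b'\<in>B. a (e b') \<otimes>\<^bsub>K\<^esub> c (e b') b)"
      using that inj c e by (intro R.finsum_reindex) (auto simp: Pi_iff)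
    also have "\<dots> = (\<Oplus>\<^bsub>K\<^esub>b'\<in>B. if b = b' then a (e b') else \<zero>\<^bsub>K\<^esub>)"
      using that by (intro R.finsum_cong') (auto simp: dual Pi_iff)
    also have "\<dots> = a (e b)"
      using that fin by (subst R.finsum_singleton) (auto simp: Pi_iff)
    finally show ?thesis .
  qed
  have "basis (e ` B)"
    unfolding basis_def
  proof (intro conjI)
    show "lin_indpt (e ` B)"
    proof (rule finite_lin_indpt2)
      fix a assume a: "a \<in> e ` B \<rightarrow> carrier K" "lincomb a (e ` B) = \<zero>\<^bsub>V\<^esub>"
      show "\<forall>v\<in>e ` B. a v = \<zero>\<^bsub>K\<^esub>"
        using coord[OF a(1)] a(2) c0 by auto
    qed (use fin eC in auto)
    show "e ` B \<subseteq> carrier V" by (rule eC)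
    show "gen_set (e ` B)"
    proof
      show "span (e ` B) \<subseteq> carrier V" using eC by (rule span_is_subset2)
      show "carrier V \<subseteq> span (e ` B)"
      proof
        fix v assume v: "v \<in> carrier V"
        define a where "a w = c v (inv_into B e w)" for w
        have a: "a \<in> e ` B \<rightarrow> carrier K" using v c inj by (auto simp: a_def)
        have ae: "a (e b) = c v b" if "b \<in> B" for b
          using that inj by (simp add: a_def)
        define u where "u = lincomb a (e ` B)"
        have u: "u \<in> carrier V" unfolding u_def by (rule lincomb_closed[OF eC a])
        define d where "d = v \<oplus>\<^bsub>V\<^esub> (\<ominus>\<^bsub>K\<^esub> \<one>\<^bsub>K\<^esub>) \<odot>\<^bsub>V\<^esub> u"
        have "d = \<zero>\<^bsub>V\<^esub>"
        proof (rule sep)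
          show "d \<in> carrier V" using u v by (auto simp: d_def)
          fix b assume b: "b \<in> B"
          have "c d b = c v b \<oplus>\<^bsub>K\<^esub> (\<ominus>\<^bsub>K\<^esub> \<one>\<^bsub>K\<^esub>) \<otimes>\<^bsub>K\<^esub> c v b"
            unfolding d_def using u v b coord[OF a b] ae[OF b]
            by (simp add: c_add c_smult u_def)
          also have "\<dots> = \<zero>\<^bsub>K\<^esub>" using c[OF v b] by (simp add: R.l_minus R.r_neg)
          finally show "c d b = \<zero>\<^bsub>K\<^esub>" .
        qed
        then have "v = u"
          using u v unfolding d_def
          by (simp add: smult_minus_1 flip: a_minus_def)
        then show "v \<in> span (e ` B)"
          unfolding span_def u_def using a fin by blast
      qed
    qed
  qed
  then have "dim = card (e ` B)" using fin by (intro dim_basis) auto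
  also have "\<dots> = card B" by (rule card_image[OF inj])
  finally show ?thesis .
qed

section \<open>Ideals of rings given by types\<close>

lemma ring_of_type_algebra_simps [simp]:
  "carrier ring_of_type_algebra = UNIV"
  "monoid.mult ring_of_type_algebra = (*)"
  "\<one>\<^bsub>ring_of_type_algebra\<^esub> = 1"
  "\<zero>\<^bsub>ring_of_type_algebra\<^esub> = 0"
  "add ring_of_type_algebra = (+)"
  by (simp_all add: ring_of_type_algebra_def)

text \<open>
  The localizations at prime ideals are subrings of a fraction field obtained by changing the
  carrier, so the ring axioms and the ideal axioms are reduced here to closure properties.
\<close>

lemma cring_carrier_update:
  fixes H :: "'a::comm_ring_1 set"
  assumes "1 \<in> H" and "0 \<in> H" and "\<And>a b. a \<in> H \<Longrightarrow> b \<in> H \<Longrightarrow> a + b \<in> H"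
    and "\<And>a b. a \<in> H \<Longrightarrow> b \<in> H \<Longrightarrow> a * b \<in> H" and "\<And>a. a \<in> H \<Longrightarrow> - a \<in> H"
  shows "cring (ring_of_type_algebra\<lparr>carrier := H\<rparr>)"
proof (rule cringI)
  show "abelian_group (ring_of_type_algebra\<lparr>carrier := H\<rparr>)"
    using assms by (intro abelian_groupI) (auto simp: algebra_simps intro!: bexI[of _ "- _"])
  show "comm_monoid (ring_of_type_algebra\<lparr>carrier := H\<rparr>)"
    using assms by (intro comm_monoidI) (auto simp: algebra_simps)
qed (auto simp: algebra_simps)

lemma ideal_carrier_updateI:
  fixes H J :: "'a::comm_ring_1 set"
  assumes cring: "cring (ring_of_type_algebra\<lparr>carrier := H\<rparr>)"
    and neg: "\<And>a. a \<in> H \<Longrightarrow> - a \<in> H"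
    and sub: "J \<subseteq> H" and J0: "0 \<in> J" and Jadd: "\<And>a b. a \<in> J \<Longrightarrow> b \<in> J \<Longrightarrow> a + b \<in> J"
    and mult: "\<And>a b. a \<in> H \<Longrightarrow> b \<in> J \<Longrightarrow> a * b \<in> J"
  shows "ideal J (ring_of_type_algebra\<lparr>carrier := H\<rparr>)" (is "ideal J ?R")
proof -
  interpret cring ?R by (rule cring)
  have one: "1 \<in> H" using one_closed by simp
  have minus: "\<ominus>\<^bsub>?R\<^esub> a = - a" if "a \<in> H" for a
    using that by (intro minus_equality) (simp_all add: neg)
  have "- a \<in> J" if "a \<in> J" for a
    using mult[OF neg[OF one] that] by simp
  then have "subgroup J (add_monoid ?R)"
    using sub J0 Jadd minus
    by (intro add.subgroupI) (auto simp: subset_iff)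
  moreover have "a * b \<in> J" if "a \<in> J" "b \<in> H" for a b
    using mult[OF that(2,1)] by (simp add: mult.commute)
  ultimately show ?thesis
    using mult by (intro idealI) (auto simp: ring_axioms)
qed

lemma ideal_typeI:
  fixes J :: "'a::comm_ring_1 set"
  assumes "0 \<in> J" and "\<And>a b. a \<in> J \<Longrightarrow> b \<in> J \<Longrightarrow> a + b \<in> J" and "\<And>a b. b \<in> J \<Longrightarrow> a * b \<in> J"
  shows "ideal J ring_of_type_algebra"
proof -
  have eq: "ring_of_type_algebra\<lparr>carrier := UNIV\<rparr> = (ring_of_type_algebra :: 'a ring)"
    by (simp add: ring_of_type_algebra_def)
  have "ideal J (ring_of_type_algebra\<lparr>carrier := UNIV\<rparr>)"
    by (rule ideal_carrier_updateI) (use assms in \<open>auto simp: eq\<close>)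
  then show ?thesis by (simp add: eq)
qed

lemma ideal_typeD:
  assumes "ideal J (ring_of_type_algebra :: 'a::comm_ring_1 ring)"
  shows "0 \<in> J" and "a \<in> J \<Longrightarrow> b \<in> J \<Longrightarrow> a + b \<in> J" and "b \<in> J \<Longrightarrow> a * b \<in> J"
proof -
  interpret ideal J "ring_of_type_algebra :: 'a ring" by (rule assms)
  show "0 \<in> J" using additive_subgroup.zero_closed[OF additive_subgroup_axioms] by simp
  show "a \<in> J \<Longrightarrow> b \<in> J \<Longrightarrow> a + b \<in> J"
    using additive_subgroup.a_closed[OF additive_subgroup_axioms, of a b] by simp
  show "b \<in> J \<Longrightarrow> a * b \<in> J" using I_l_closed[of b a] by simp
qed

section \<open>Monomial ideals\<close>

type_synonym mon = "3 \<Rightarrow>\<^sub>0 nat"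

definition monomial_ideal :: "mon set \<Rightarrow> 'k::field poly3 set" where
  "monomial_ideal E = {f. Poly_Mapping.keys f \<subseteq> E}"

text \<open>
  These are the exponent sets of monomial ideals: exactly for them the polynomials supported
  in \<open>E\<close> form an ideal.
\<close>

definition translation_closed :: "mon set \<Rightarrow> bool" where
  "translation_closed E \<longleftrightarrow> (\<forall>d. \<forall>e\<in>E. d + e \<in> E)"

lemma keys_mult_obtain:
  fixes f g :: "'k::field poly3"
  assumes "e \<in> Poly_Mapping.keys (f * g)"
  obtains a b where "a \<in> Poly_Mapping.keys f" "b \<in> Poly_Mapping.keys g" "e = a + b"
  using assms keys_mult[of f g] by blast

lemma zero_in_monomial_ideal: "0 \<in> monomial_ideal E"
  by (simp add: monomial_ideal_def)

lemma add_in_monomial_ideal: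
  "f \<in> monomial_ideal E \<Longrightarrow> g \<in> monomial_ideal E \<Longrightarrow> f + g \<in> monomial_ideal E"
  using keys_add[of f g] by (auto simp: monomial_ideal_def)

lemma uminus_in_monomial_ideal: "f \<in> monomial_ideal E \<Longrightarrow> - f \<in> monomial_ideal E"
  by (auto simp: monomial_ideal_def in_keys_iff)

lemma diff_in_monomial_ideal:
  "f \<in> monomial_ideal E \<Longrightarrow> g \<in> monomial_ideal E \<Longrightarrow> f - g \<in> monomial_ideal E"
  using add_in_monomial_ideal[of f E "- g"] uminus_in_monomial_ideal[of g E] by simp

lemma mult_in_monomial_ideal:
  assumes "translation_closed E" "f \<in> monomial_ideal E"
  shows "g * f \<in> monomial_ideal E"
  using assms unfolding monomial_ideal_def translation_closed_def
  by (auto elim!: keys_mult_obtain)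

lemma single_in_monomial_ideal: "e \<in> E \<Longrightarrow> Poly_Mapping.single e c \<in> monomial_ideal E"
  by (auto simp: monomial_ideal_def)

lemma sum_of_terms:
  fixes f :: "'a \<Rightarrow>\<^sub>0 'b::comm_monoid_add"
  shows "f = (\<Sum>e\<in>Poly_Mapping.keys f. Poly_Mapping.single e (Poly_Mapping.lookup f e))"
proof (rule poly_mapping_eqI)
  fix e
  have "Poly_Mapping.lookup (\<Sum>e\<in>Poly_Mapping.keys f. Poly_Mapping.single e (Poly_Mapping.lookup f e)) e
      = (\<Sum>d\<in>Poly_Mapping.keys f. if d = e then Poly_Mapping.lookup f d else 0)"
    by (simp add: lookup_sum lookup_single when_def)
  also have "\<dots> = Poly_Mapping.lookup f e"
    by (simp add: in_keys_iff)
  finally show "Poly_Mapping.lookup f e = Poly_Mapping.lookup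
      (\<Sum>e\<in>Poly_Mapping.keys f. Poly_Mapping.single e (Poly_Mapping.lookup f e)) e" by simp
qed

lemma closed_under_terms:
  fixes f :: "'a \<Rightarrow>\<^sub>0 'b::comm_monoid_add"
  assumes "0 \<in> J" and "\<And>f g. f \<in> J \<Longrightarrow> g \<in> J \<Longrightarrow> f + g \<in> J"
    and "\<And>e. e \<in> Poly_Mapping.keys f \<Longrightarrow> Poly_Mapping.single e (Poly_Mapping.lookup f e) \<in> J"
  shows "f \<in> J"
proof -
  have "(\<Sum>e\<in>A. Poly_Mapping.single e (Poly_Mapping.lookup f e)) \<in> J"
    if "finite A" "A \<subseteq> Poly_Mapping.keys f" for A
    using that by (induction A) (auto intro: assms)
  then show ?thesis using sum_of_terms[of f] by (metis finite_keys order_refl)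
qed

lemma ideal_monomial_ideal:
  "translation_closed E \<Longrightarrow> ideal (monomial_ideal E) poly3_ring"
  by (rule ideal_typeI)
    (auto simp: zero_in_monomial_ideal add_in_monomial_ideal mult_in_monomial_ideal)

lemma monomial_ideal_subsetI:
  fixes J :: "'k::field poly3 set"
  assumes "ideal J poly3_ring" and "\<And>e. e \<in> E \<Longrightarrow> Poly_Mapping.single e 1 \<in> J"
  shows "monomial_ideal E \<subseteq> J"
proof
  fix f :: "'k poly3" assume f: "f \<in> monomial_ideal E"
  show "f \<in> J"
  proof (rule closed_under_terms)
    fix e assume "e \<in> Poly_Mapping.keys f"
    then have "Poly_Mapping.single e 1 \<in> J" using f assms(2) by (auto simp: monomial_ideal_def)
    from ideal_typeD(3)[OF assms(1) this, of "Poly_Mapping.single 0 (Poly_Mapping.lookup f e)"]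
    show "Poly_Mapping.single e (Poly_Mapping.lookup f e) \<in> J" by (simp add: mult_single)
  qed (use ideal_typeD[OF assms(1)] in auto)
qed

lemma ideal_prod_monomial_ideal:
  assumes "translation_closed E" "translation_closed F"
    and "\<And>g. g \<in> G \<longleftrightarrow> (\<exists>e\<in>E. \<exists>f\<in>F. g = e + f)"
  shows "ideal_prod poly3_ring (monomial_ideal E) (monomial_ideal F)
      = (monomial_ideal G :: 'k::field poly3 set)" (is "?P = _")
proof
  show "?P \<subseteq> monomial_ideal G"
  proof
    fix s assume "s \<in> ?P"
    then show "s \<in> monomial_ideal G"
    proof induction
      case (prod i j)
      then show ?case
        unfolding monomial_ideal_def by (auto elim!: keys_mult_obtain simp: assms(3)) blast
    next
      case (sum s1 s2)
      then show ?case by (simp add: add_in_monomial_ideal)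
    qed
  qed
  interpret R: cring "poly3_ring :: 'k poly3 ring" by (rule cring_from_type_algebra)
  have "ideal ?P poly3_ring"
    by (intro R.ideal_prod_is_ideal ideal_monomial_ideal assms)
  then show "monomial_ideal G \<subseteq> ?P"
  proof (rule monomial_ideal_subsetI)
    fix g assume "g \<in> G"
    then obtain e f where "e \<in> E" "f \<in> F" "g = e + f" using assms(3) by blast
    then have "Poly_Mapping.single e 1 \<otimes>\<^bsub>poly3_ring\<^esub> Poly_Mapping.single f 1 \<in> ?P"
      by (intro ideal_prod.prod single_in_monomial_ideal)
    then show "Poly_Mapping.single g 1 \<in> ?P" by (simp add: mult_single \<open>g = e + f\<close>)
  qed
qed

section \<open>Cancelling factors of weight zero\<close>

text \<open>
  An additive weight grades the polynomial ring. If \<open>f\<close> has a component \<open>f\<^sub>m\<close> of weight \<open>m < n\<close>, chosen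
  minimal, and \<open>s\<close> has a nonzero component \<open>s\<^sub>0\<close> of weight zero, then the component of weight \<open>m\<close> of \<open>s * f\<close>
  is \<open>s\<^sub>0 * f\<^sub>m\<close>, which is nonzero in a domain. With \<open>n = 1\<close> this says that the ideal of
  polynomials of positive weight is prime; for \<open>n \<ge> 1\<close> it says that the ideal of polynomials of weight
  at least \<open>n\<close> is primary to that prime, so that it is not changed by localizing and contracting.
\<close>

lemma mult_in_weight_ideal_cancel:
  fixes s f :: "'k::field poly3" and w :: "mon \<Rightarrow> nat"
  assumes w: "\<And>d e. w (d + e) = w d + w e"
    and s: "s \<notin> monomial_ideal {e. 1 \<le> w e}"
    and sf: "s * f \<in> monomial_ideal {e. n \<le> w e}"
  shows "f \<in> monomial_ideal {e. n \<le> w e}"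
  using sf
proof (induction n)
  case 0
  then show ?case by (simp add: monomial_ideal_def)
next
  case (Suc n)
  let ?Q = "\<lambda>m. monomial_ideal {e. m \<le> w e} :: 'k poly3 set"
  define part :: "nat \<Rightarrow> 'k poly3 \<Rightarrow> 'k poly3"
    where "part m g = Poly_Mapping.mapp (\<lambda>e c. if w e = m then c else 0) g" for m g
  have lookup_part: "Poly_Mapping.lookup (part m g) e
      = (if w e = m then Poly_Mapping.lookup g e else 0)" for m g e
    by (auto simp: part_def Poly_Mapping.lookup_mapp when_def in_keys_iff)
  have rest: "g - part m g \<in> ?Q (Suc m)" if "g \<in> ?Q m" for g m
    using that by (fastforce simp: monomial_ideal_def in_keys_iff lookup_minus lookup_part
        split: if_splits)
  have tc: "translation_closed {e. m \<le> w e}" for m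
    by (auto simp: translation_closed_def w)
  \<comment> \<open>As \<open>f\<close> has weight at least \<open>n\<close>, it remains to remove its component of weight \<open>n\<close>.\<close>
  have "s * f \<in> ?Q n" using Suc.prems by (auto simp: monomial_ideal_def)
  then have f: "f \<in> ?Q n" by (rule Suc.IH)
  have "s * (f - part n f) \<in> ?Q (Suc n)" by (intro mult_in_monomial_ideal tc rest f)
  moreover have "(s - part 0 s) * part n f \<in> ?Q (Suc n)"
  proof -
    have "s - part 0 s \<in> ?Q (Suc 0)" by (rule rest) (simp add: monomial_ideal_def)
    then show ?thesis
      by (fastforce simp: monomial_ideal_def w in_keys_iff lookup_part elim!: keys_mult_obtain
          split: if_splits)
  qed
  moreover have "part 0 s * part n f = s * f - s * (f - part n f) - (s - part 0 s) * part n f"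
    by (simp add: algebra_simps)
  ultimately have "part 0 s * part n f \<in> ?Q (Suc n)"
    using Suc.prems by (metis diff_in_monomial_ideal)
  moreover have "w e = n" if e: "e \<in> Poly_Mapping.keys (part 0 s * part n f)" for e
  proof -
    obtain a b where "a \<in> Poly_Mapping.keys (part 0 s)" "b \<in> Poly_Mapping.keys (part n f)" "e = a + b"
      using e by (rule keys_mult_obtain)
    then show ?thesis by (auto simp: w in_keys_iff lookup_part split: if_splits)
  qed
  ultimately have "Poly_Mapping.keys (part 0 s * part n f) = {}"
    by (fastforce simp: monomial_ideal_def)
  then have "part 0 s * part n f = 0" by (simp add: keys_eq_empty)
  moreover have "part 0 s \<noteq> 0"
  proof
    assume "part 0 s = 0"
    then have "s \<in> ?Q (Suc 0)"
      using rest[of s 0] by (simp add: monomial_ideal_def)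
    then show False using s by simp
  qed
  ultimately have "part n f = 0" by simp
  then show ?case using rest[OF f] by simp
qed

section \<open>Ideals as modules, associated primes and localizations\<close>

lemma module_ideal_module:
  fixes J :: "'a::comm_ring_1 set"
  assumes "ideal J ring_of_type_algebra"
  shows "module ring_of_type_algebra (ideal_module ring_of_type_algebra J)"
proof (rule module_criteria)
  have "- a \<in> J" if "a \<in> J" for a
    using ideal_typeD(3)[OF assms that, of "- 1"] by simp
  then show "\<forall>v\<in>carrier (ideal_module ring_of_type_algebra J).
      \<exists>w\<in>carrier (ideal_module ring_of_type_algebra J).
        v \<oplus>\<^bsub>ideal_module ring_of_type_algebra J\<^esub> w = \<zero>\<^bsub>ideal_module ring_of_type_algebra J\<^esub>"
    by (auto intro!: bexI[of _ "- _"])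
qed (use ideal_typeD[OF assms] in 
    \<open>auto simp: distrib_left distrib_right mult.assoc add.assoc add.commute cring_from_type_algebra\<close>)

lemma submodule_ideal_module:
  fixes J :: "'a::comm_ring_1 set"
  assumes "ideal J ring_of_type_algebra" "ideal N ring_of_type_algebra" "N \<subseteq> J"
  shows "LinearCombinations.submodule ring_of_type_algebra N (ideal_module ring_of_type_algebra J)"
  using module_ideal_module[OF assms(1)] ideal_typeD[OF assms(2)] assms(3)
  by (intro LinearCombinations.submodule.intro) auto

text \<open>
  This removes the cosets from the definition: annihilators of elements of \<open>R / I\<close> are colon ideals.
\<close>

lemma associated_primes_of_ideal:
  fixes I :: "'a::comm_ring_1 set"
  assumes I: "ideal I ring_of_type_algebra"
  shows "associated_primes ring_of_type_algebra
      (module_quot (ideal_module ring_of_type_algebra (carrier ring_of_type_algebra)) I)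
    = {P. primeideal P ring_of_type_algebra \<and> (\<exists>g. P = {r. r * g \<in> I})}"
proof -
  let ?R = "ring_of_type_algebra :: 'a ring"
  let ?M = "ideal_module ?R UNIV"
  have U: "ideal UNIV ?R" by (rule ideal_typeI) auto
  interpret M: module ?R ?M by (rule module_ideal_module[OF U])
  have sub: "LinearCombinations.submodule ?R I ?M"
    by (rule submodule_ideal_module[OF U I]) auto
  have smult: "(\<Union>y\<in>I +>\<^bsub>?M\<^esub> g. I +>\<^bsub>?M\<^esub> (r * y)) = I \<longleftrightarrow> r * g \<in> I" for r g
    using M.smult_coset[OF sub, of r g] M.coset_eq_self_iff[OF sub, of "r * g"] by simp
  show ?thesis
    by (simp add: associated_primes_def M.carrier_module_quot smult)
qed

lemma mem_extended_idealI:
  fixes f :: "'a::idom"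
  assumes "0 \<in> P" "s \<notin> P" "s * f \<in> J"
  shows "Fraction_Field.Fract f 1 \<in> extended_ideal P J"
proof -
  have s: "s \<noteq> 0" using assms by auto
  have "Fraction_Field.Fract f 1 \<in> K"
    if K: "ideal K (localization_at P)" "(\<lambda>a. Fraction_Field.Fract a 1) ` J \<subseteq> K" for K
  proof -
    interpret K: ideal K "localization_at P" by (rule K)
    have "Fraction_Field.Fract (s * f) 1 \<in> K" using K(2) assms by blast
    moreover have "Fraction_Field.Fract 1 s \<in> carrier (localization_at P)"
      using assms by (auto simp: localization_at_def)
    ultimately have "Fraction_Field.Fract 1 s \<otimes>\<^bsub>localization_at P\<^esub> Fraction_Field.Fract (s * f) 1 \<in> K"
      by (rule K.I_l_closed)
    moreover have "Fraction_Field.Fract 1 s * Fraction_Field.Fract (s * f) 1 = Fraction_Field.Fract f 1"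
      using s by (simp add: eq_fract)
    ultimately show ?thesis by (simp add: localization_at_def)
  qed
  then show ?thesis unfolding extended_ideal_def genideal_def by blast
qed

text \<open>
  If elements outside \<open>P\<close> are cancellable modulo \<open>Q\<close>, then the fractions with numerator in \<open>Q\<close> form an ideal
  of the localization that contracts to \<open>Q\<close> again. It contains every ideal extended from a subset
  of \<open>Q\<close>, which bounds the contraction of such an extended ideal from above.
\<close>

lemma mem_extended_idealD:
  fixes P Q J :: "'a::idom set"
  assumes P: "primeideal P ring_of_type_algebra"
    and Q: "ideal Q ring_of_type_algebra" "J \<subseteq> Q"
    and cancel: "\<And>s f. s \<notin> P \<Longrightarrow> s * f \<in> Q \<Longrightarrow> f \<in> Q"
    and f: "Fraction_Field.Fract f 1 \<in> extended_ideal P J"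
  shows "f \<in> Q"
proof -
  interpret P: primeideal P "ring_of_type_algebra :: 'a ring" by (rule P)
  have zero: "0 \<in> P" by (rule ideal_typeD(1)[OF P.is_ideal])
  have one: "1 \<notin> P" using P.one_imp_carrier P.I_notcarr by auto
  have mult: "s * t \<notin> P" if "s \<notin> P" "t \<notin> P" for s t
    using P.I_prime[of s t] that by auto
  have nz: "s \<noteq> 0" if "s \<notin> P" for s using zero that by auto
  define H where "H = {Fraction_Field.Fract a s | a s. s \<notin> P}"
  define L where "L = {Fraction_Field.Fract a s | a s. a \<in> Q \<and> s \<notin> P}"
  have loc: "localization_at P = ring_of_type_algebra\<lparr>carrier := H\<rparr>"
    by (simp add: localization_at_def H_def)
  have H_neg: "- x \<in> H" if "x \<in> H" for x
    using that nz by (auto simp: H_def) (metis minus_fract)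
  have H_ops: "x + y \<in> H" "x * y \<in> H" if xy: "x \<in> H" "y \<in> H" for x y
  proof -
    obtain a s b t where "x = Fraction_Field.Fract a s" "y = Fraction_Field.Fract b t" "s \<notin> P" "t \<notin> P"
      using xy by (auto simp: H_def)
    then show "x + y \<in> H" "x * y \<in> H"
      using mult nz by (auto simp: H_def)
  qed
  have "cring (localization_at P)"
    unfolding loc
  proof (rule cring_carrier_update)
    show "1 \<in> H" using one by (auto simp: H_def One_fract_def)
    show "0 \<in> H" using one by (auto simp: H_def Zero_fract_def)
  qed (use H_neg H_ops in auto)
  then have "ideal L (localization_at P)"
    unfolding loc
  proof (rule ideal_carrier_updateI)
    show "L \<subseteq> H" by (auto simp: L_def H_def)
    show "0 \<in> L" using one ideal_typeD(1)[OF Q(1)] by (auto simp: L_def Zero_fract_def)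
    show "- x \<in> H" if "x \<in> H" for x using H_neg that .
    show "x + y \<in> L" if xy: "x \<in> L" "y \<in> L" for x y
    proof -
      obtain a s b t where "x = Fraction_Field.Fract a s" "y = Fraction_Field.Fract b t"
        and st: "s \<notin> P" "t \<notin> P" and ab: "a \<in> Q" "b \<in> Q"
        using xy by (auto simp: L_def)
      then have "x + y = Fraction_Field.Fract (t * a + s * b) (s * t)"
        using nz by (simp add: mult.commute)
      moreover have "t * a + s * b \<in> Q" using ab by (intro ideal_typeD[OF Q(1)])
      ultimately show ?thesis using mult[OF st] by (auto simp: L_def)
    qed
    show "x * y \<in> L" if xy: "x \<in> H" "y \<in> L" for x y
    proof -
      obtain a s b t where "x = Fraction_Field.Fract a s" "y = Fraction_Field.Fract b t"
        and st: "s \<notin> P" "t \<notin> P" and b: "b \<in> Q"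
        using xy by (auto simp: L_def H_def)
      then have "x * y = Fraction_Field.Fract (a * b) (s * t)" by simp
      moreover have "a * b \<in> Q" using b by (rule ideal_typeD[OF Q(1)])
      ultimately show ?thesis using mult[OF st] by (auto simp: L_def)
    qed
  qed
  moreover have "(\<lambda>a. Fraction_Field.Fract a 1) ` J \<subseteq> L"
    using Q(2) one by (auto simp: L_def)
  ultimately have "extended_ideal P J \<subseteq> L"
    unfolding extended_ideal_def genideal_def by blast
  then obtain a s where "Fraction_Field.Fract f 1 = Fraction_Field.Fract a s" "a \<in> Q" "s \<notin> P"
    using f by (auto simp: L_def)
  then have "s * f \<in> Q" using nz by (simp add: eq_fract mult.commute)
  then show ?thesis using cancel \<open>s \<notin> P\<close> by blast
qed

section \<open>Exponents of the powers\<close>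

lemma UNIV_3: "(UNIV :: 3 set) = {1, 2, 3}"
proof -
  have "card {1, 2, 3 :: 3} = CARD(3)" by simp
  then show ?thesis using card_subset_eq[of "UNIV :: 3 set" "{1, 2, 3}"] by simp
qed

lemma all_3: "(\<forall>i::3. P i) \<longleftrightarrow> P 1 \<and> P 2 \<and> P 3"
proof -
  have "(\<forall>i. P i) \<longleftrightarrow> (\<forall>i\<in>{1, 2, 3}. P i)" unfolding UNIV_3[symmetric] by simp
  then show ?thesis by simp
qed

text \<open>
  The polynomials all of whose exponents have positive \<open>coweight k\<close> form the prime ideal generated by
  the two variables other than the one with index \<open>k\<close>.
\<close>

definition coweight :: "3 \<Rightarrow> mon \<Rightarrow> nat" where
  "coweight k e = (\<Sum>i\<in>-{k}. Poly_Mapping.lookup e i)"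

definition total_degree :: "mon \<Rightarrow> nat" where
  "total_degree e = (\<Sum>i\<in>UNIV. Poly_Mapping.lookup e i)"

text \<open>
  The monomials that lie in the \<open>n\<close>-th power of each of the three primes generated by two variables.
\<close>

definition symbolic_exponents :: "nat \<Rightarrow> mon set" where
  "symbolic_exponents n = {e. \<forall>k. n \<le> coweight k e}"

text \<open>
  The \<open>n\<close>-th power of the ideal is generated by monomials of degree \<open>2 * n\<close>; the bound on the total
  degree is the only condition that separates it from the symbolic power.
\<close>

definition power_exponents :: "nat \<Rightarrow> mon set" where
  "power_exponents n = {e \<in> symbolic_exponents n. 2 * n \<le> total_degree e}"

lemma compl_3: "- {1} = {2, 3 :: 3}" "- {2} = {1, 3 :: 3}" "- {3} = {1, 2 :: 3}"
  unfolding Compl_eq_Diff_UNIV UNIV_3 by auto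

lemma coweight_simps:
  "coweight 1 e = Poly_Mapping.lookup e 2 + Poly_Mapping.lookup e 3"
  "coweight 2 e = Poly_Mapping.lookup e 1 + Poly_Mapping.lookup e 3"
  "coweight 3 e = Poly_Mapping.lookup e 1 + Poly_Mapping.lookup e 2"
  unfolding coweight_def compl_3 by simp_all

lemma total_degree_eq:
  "total_degree e = Poly_Mapping.lookup e 1 + Poly_Mapping.lookup e 2 + Poly_Mapping.lookup e 3"
  unfolding total_degree_def UNIV_3 by simp

lemma coweight_add: "coweight k (d + e) = coweight k d + coweight k e"
  by (simp add: coweight_def lookup_add sum.distrib)

lemma total_degree_add: "total_degree (d + e) = total_degree d + total_degree e"
  by (simp add: total_degree_def lookup_add sum.distrib)

lemma mem_symbolic_exponents_iff:
  "e \<in> symbolic_exponents n \<longleftrightarrow>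
    n \<le> Poly_Mapping.lookup e 2 + Poly_Mapping.lookup e 3 \<and>
    n \<le> Poly_Mapping.lookup e 1 + Poly_Mapping.lookup e 3 \<and>
    n \<le> Poly_Mapping.lookup e 1 + Poly_Mapping.lookup e 2"
  unfolding symbolic_exponents_def by (simp add: all_3 coweight_simps)

lemma mem_power_exponents_iff:
  "e \<in> power_exponents n \<longleftrightarrow> e \<in> symbolic_exponents n \<and>
    2 * n \<le> Poly_Mapping.lookup e 1 + Poly_Mapping.lookup e 2 + Poly_Mapping.lookup e 3"
  by (simp add: power_exponents_def total_degree_eq)

lemma translation_closed_coweight: "translation_closed {e. n \<le> coweight k e}"
  by (auto simp: translation_closed_def coweight_add)

lemma translation_closed_symbolic_exponents: "translation_closed (symbolic_exponents n)"
  by (auto simp: translation_closed_def symbolic_exponents_def coweight_add trans_le_add2)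

lemma translation_closed_power_exponents: "translation_closed (power_exponents n)"
  using translation_closed_symbolic_exponents[of n]
  by (auto simp: translation_closed_def power_exponents_def total_degree_add trans_le_add2)

definition var_pair :: "3 \<Rightarrow> mon" where
  "var_pair k = (\<Sum>i\<in>-{k}. Poly_Mapping.single i 1)"

lemma lookup_var_pair: "Poly_Mapping.lookup (var_pair k) i = (if i = k then 0 else 1)"
proof -
  have "Poly_Mapping.lookup (var_pair k) i = (\<Sum>j\<in>-{k}. if j = i then 1 else 0)"
    by (simp add: var_pair_def lookup_sum lookup_single when_def)
  then show ?thesis by simp
qed

lemma var_pair_mem: "var_pair k \<in> power_exponents 1"
proof -
  have "\<forall>k. var_pair k \<in> power_exponents 1"
    by (simp add: all_3 mem_power_exponents_iff mem_symbolic_exponents_iff lookup_var_pair)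
  then show ?thesis by blast
qed

lemma poly_mapping_nat_leE:
  fixes d e :: "'a \<Rightarrow>\<^sub>0 nat"
  assumes "\<And>i. Poly_Mapping.lookup d i \<le> Poly_Mapping.lookup e i"
  obtains d' where "e = d' + d"
proof (rule that)
  show "e = (e - d) + d"
    by (rule poly_mapping_eqI) (simp add: lookup_add lookup_minus assms)
qed

text \<open>
  Dividing by the two variables with the largest exponents stays in range. If \<open>k\<close> is the index of a
  smallest exponent, then only \<open>coweight k\<close> drops by two, and there is room for this: the two
  exponents other than the smallest add up to at least two thirds of \<open>2 * (n + 1)\<close>, hence to at
  least \<open>n + 2\<close>.
\<close>

lemma var_pair_split:
  assumes "e \<in> power_exponents (Suc n)"
  obtains d k where "d \<in> power_exponents n" "e = d + var_pair k"
proof -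
  let ?e = "Poly_Mapping.lookup e"
  have "Min (range ?e) \<in> range ?e" by (rule Min_in) simp_all
  then obtain k where "Min (range ?e) = ?e k" by (rule rangeE)
  then have k: "?e k \<le> ?e i" for i using Min_le[of "range ?e" "?e i"] by simp
  have k_cases: "k = 1 \<or> k = 2 \<or> k = 3" using UNIV_I[of k] unfolding UNIV_3 by simp
  have e: "Suc n \<le> ?e 2 + ?e 3" "Suc n \<le> ?e 1 + ?e 3" "Suc n \<le> ?e 1 + ?e 2"
    "2 * Suc n \<le> ?e 1 + ?e 2 + ?e 3"
    using assms unfolding mem_power_exponents_iff mem_symbolic_exponents_iff by blast+
  have "\<forall>i. Poly_Mapping.lookup (var_pair k) i \<le> ?e i"
    unfolding all_3 lookup_var_pair using k_cases e k[of 1] k[of 2] k[of 3]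
    by (elim disjE) simp_all
  then obtain d where d: "e = d + var_pair k" using poly_mapping_nat_leE by blast
  let ?d = "Poly_Mapping.lookup d"
  have ed: "?e i = ?d i + (if i = k then 0 else 1)" for i
    by (simp add: d lookup_add lookup_var_pair)
  have "d \<in> power_exponents n"
    unfolding mem_power_exponents_iff mem_symbolic_exponents_iff
    using k_cases k[of 1] k[of 2] k[of 3] e unfolding ed by (elim disjE) simp_all
  with d that show thesis by blast
qed

lemma power_exponents_Suc:
  "g \<in> power_exponents (Suc n) \<longleftrightarrow> (\<exists>e\<in>power_exponents n. \<exists>f\<in>power_exponents 1. g = e + f)"
proof
  assume "g \<in> power_exponents (Suc n)"
  then show "\<exists>e\<in>power_exponents n. \<exists>f\<in>power_exponents 1. g = e + f"
    by (elim var_pair_split) (use var_pair_mem in blast)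
qed (auto simp: mem_power_exponents_iff mem_symbolic_exponents_iff lookup_add)

lemma lookup_single_mult:
  fixes f :: "'k::field poly3"
  shows "Poly_Mapping.lookup (Poly_Mapping.single d c * f) (d + e) = c * Poly_Mapping.lookup f e"
proof -
  have "f \<in> {f. Poly_Mapping.lookup (Poly_Mapping.single d c * f) (d + e) = c * Poly_Mapping.lookup f e}"
    by (rule closed_under_terms)
      (simp_all add: distrib_left lookup_add mult_single lookup_single when_def)
  then show ?thesis by simp
qed

lemma keys_single_mult:
  fixes f :: "'k::field poly3"
  shows "Poly_Mapping.keys (Poly_Mapping.single d 1 * f) = (+) d ` Poly_Mapping.keys f"
proof
  show "Poly_Mapping.keys (Poly_Mapping.single d 1 * f) \<subseteq> (+) d ` Poly_Mapping.keys f"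
    by (auto elim!: keys_mult_obtain)
  show "(+) d ` Poly_Mapping.keys f \<subseteq> Poly_Mapping.keys (Poly_Mapping.single d 1 * f)"
    by (auto simp: in_keys_iff lookup_single_mult)
qed

lemma poly3_var_products:
  "x_var * y_var = (Poly_Mapping.single (var_pair 3) 1 :: 'k::field poly3)"
  "x_var * z_var = (Poly_Mapping.single (var_pair 2) 1 :: 'k::field poly3)"
  "y_var * z_var = (Poly_Mapping.single (var_pair 1) 1 :: 'k::field poly3)"
  unfolding poly3_var_def var_pair_def compl_3 by (simp_all add: mult_single add.commute)

lemma monomial_ideal_var_pairs:
  "Idl\<^bsub>poly3_ring\<^esub> {x_var * y_var, x_var * z_var, y_var * z_var}
    = (monomial_ideal (power_exponents 1) :: 'k::field poly3 set)" (is "Idl\<^bsub>_\<^esub> ?S = ?I")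
proof
  interpret R: cring "poly3_ring :: 'k poly3 ring" by (rule cring_from_type_algebra)
  have I: "ideal ?I poly3_ring"
    by (rule ideal_monomial_ideal[OF translation_closed_power_exponents])
  have "?S \<subseteq> ?I"
    unfolding poly3_var_products using var_pair_mem by (simp add: single_in_monomial_ideal)
  then show "Idl\<^bsub>poly3_ring\<^esub> ?S \<subseteq> ?I" by (rule R.genideal_minimal[OF I])
  have G: "ideal (Idl\<^bsub>poly3_ring\<^esub> ?S) poly3_ring" by (rule R.genideal_ideal) simp
  have gen: "?S \<subseteq> Idl\<^bsub>poly3_ring\<^esub> ?S" by (rule R.genideal_self) simp
  show "?I \<subseteq> Idl\<^bsub>poly3_ring\<^esub> ?S"
  proof (rule monomial_ideal_subsetI[OF G])
    fix e assume "e \<in> power_exponents 1"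
    then have "e \<in> power_exponents (Suc 0)" by simp
    then obtain d k where e: "e = d + var_pair k" by (rule var_pair_split)
    have "\<forall>k. Poly_Mapping.single (var_pair k) 1 \<in> Idl\<^bsub>poly3_ring\<^esub> ?S"
      unfolding all_3 using gen by (simp add: poly3_var_products)
    then have "Poly_Mapping.single d 1 * Poly_Mapping.single (var_pair k) 1 \<in> Idl\<^bsub>poly3_ring\<^esub> ?S"
      using ideal_typeD(3)[OF G] by blast
    then show "Poly_Mapping.single e 1 \<in> Idl\<^bsub>poly3_ring\<^esub> ?S" by (simp add: e mult_single)
  qed
qed

lemma power_exponents_0: "power_exponents 0 = UNIV"
  by (auto simp: mem_power_exponents_iff mem_symbolic_exponents_iff)

lemma ideal_power_eq:
  "ideal_power (monomial_ideal (power_exponents 1)) n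
    = (monomial_ideal (power_exponents n) :: 'k::field poly3 set)"
proof (induction n)
  case 0
  then show ?case
    by (simp add: ideal_power_def nat_pow_def ideals_set_def power_exponents_0 monomial_ideal_def)
next
  case (Suc n)
  have "ideal_power (monomial_ideal (power_exponents 1)) (Suc n)
      = ideal_prod poly3_ring (ideal_power (monomial_ideal (power_exponents 1)) n)
          (monomial_ideal (power_exponents 1) :: 'k poly3 set)"
    by (simp add: ideal_power_def nat_pow_def ideals_set_def)
  also have "\<dots> = monomial_ideal (power_exponents (Suc n))"
    unfolding Suc
    by (intro ideal_prod_monomial_ideal translation_closed_power_exponents power_exponents_Suc)
  finally show ?case .
qed

section \<open>The symbolic powers\<close>

lemma primeideal_coweight:
  "primeideal (monomial_ideal {e. 1 \<le> coweight k e} :: 'k::field poly3 set) poly3_ring"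
    (is "primeideal ?P _")
proof (rule primeidealI)
  show "ideal ?P poly3_ring" by (rule ideal_monomial_ideal[OF translation_closed_coweight])
  show "cring (poly3_ring :: 'k poly3 ring)" by (rule cring_from_type_algebra)
  have "1 \<notin> ?P" by (simp add: monomial_ideal_def coweight_def)
  then show "carrier poly3_ring \<noteq> ?P" by auto
  show "a \<in> ?P \<or> b \<in> ?P" if "a \<otimes>\<^bsub>poly3_ring\<^esub> b \<in> ?P" for a b
    using mult_in_weight_ideal_cancel[where w = "coweight k" and s = a and f = b and n = 1] that
    by (auto simp: coweight_add)
qed

lemma shift_mem_power_exponents_iff:
  "Poly_Mapping.single k 1 + e \<in> power_exponents 1 \<longleftrightarrow> 1 \<le> coweight k e"
proof -
  have "\<forall>k. Poly_Mapping.single k 1 + e \<in> power_exponents 1 \<longleftrightarrow> 1 \<le> coweight k e"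
    unfolding all_3 coweight_simps mem_power_exponents_iff mem_symbolic_exponents_iff
    by (auto simp: lookup_add lookup_single when_def)
  then show ?thesis by blast
qed

text \<open>
  So the prime of \<open>coweight k\<close> is associated: it is the annihilator of the class of the variable
  with index \<open>k\<close>.
\<close>

lemma annihilator_var:
  "{r. r * poly3_var k \<in> monomial_ideal (power_exponents 1)}
    = (monomial_ideal {e. 1 \<le> coweight k e} :: 'k::field poly3 set)"
proof -
  have "r * poly3_var k \<in> monomial_ideal (power_exponents 1) \<longleftrightarrow>
      r \<in> monomial_ideal {e. 1 \<le> coweight k e}" for r :: "'k poly3"
    unfolding monomial_ideal_def poly3_var_def mult.commute[of r]
    by (auto simp: keys_single_mult image_subset_iff shift_mem_power_exponents_iff simp del: One_nat_def)
  then show ?thesis by blast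
qed

text \<open>
  The maximal ideal is not associated. A monomial outside the ideal is a power of a single variable, and
  it stays outside after multiplication by that same variable.
\<close>

lemma annihilator_misses_var:
  fixes g :: "'k::field poly3"
  assumes "g \<notin> monomial_ideal (power_exponents 1)"
  shows "\<exists>k. poly3_var k * g \<notin> monomial_ideal (power_exponents 1)"
proof -
  obtain e where e: "e \<in> Poly_Mapping.keys g" "e \<notin> power_exponents 1"
    using assms by (auto simp: monomial_ideal_def)
  have "\<not> (\<forall>k. 1 \<le> coweight k e)"
    using e(2) unfolding all_3 coweight_simps mem_power_exponents_iff mem_symbolic_exponents_iff
    by auto
  then obtain k where "\<not> 1 \<le> coweight k e" by blast
  then have "Poly_Mapping.single k 1 + e \<notin> power_exponents 1"
    by (simp only: shift_mem_power_exponents_iff simp_thms)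
  then have "poly3_var k * g \<notin> monomial_ideal (power_exponents 1)"
    using e(1) by (auto simp: monomial_ideal_def poly3_var_def keys_single_mult)
  then show ?thesis by blast
qed

text \<open>
  Multiplication by \<open>n\<close>-th powers of one variable raises the total degree enough to turn elements of
  the symbolic power into elements of the ordinary power.
\<close>

lemma var_power_shift:
  assumes "e \<in> symbolic_exponents n"
  shows "Poly_Mapping.single k n + e \<in> power_exponents n"
proof -
  have "\<forall>k. Poly_Mapping.single k n + e \<in> power_exponents n"
    using assms unfolding all_3 mem_power_exponents_iff mem_symbolic_exponents_iff
    by (auto simp: lookup_add lookup_single when_def)
  then show ?thesis by blast
qed

text \<open>
  The upper bound comes from the three primes of the coweights, which are associated and to which the
  ideals of polynomials of coweight at least \<open>n\<close> are primary. The lower bound treats all associated primes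
  at once: each of them misses some variable, and the \<open>n\<close>-th power of this variable multiplies
  elements supported on \<open>symbolic_exponents n\<close> into the ordinary power.
\<close>

lemma symbolic_power_eq:
  "symbolic_power (monomial_ideal (power_exponents 1)) n
    = (monomial_ideal (symbolic_exponents n) :: 'k::field poly3 set)"
proof -
  let ?I = "monomial_ideal (power_exponents 1) :: 'k poly3 set"
  let ?Ass = "{P. primeideal P poly3_ring \<and> (\<exists>g. P = {r. r * g \<in> ?I})}"
  have "ideal ?I poly3_ring"
    by (rule ideal_monomial_ideal[OF translation_closed_power_exponents])
  note I = this
  have symb: "symbolic_power ?I n = (\<Inter>P\<in>?Ass.
      {f. Fraction_Field.Fract f 1 \<in> extended_ideal P (monomial_ideal (power_exponents n))})"
    unfolding symbolic_power_def Let_def associated_primes_of_ideal[OF I] ideal_power_eq by simp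
  show ?thesis
  proof
    show "symbolic_power ?I n \<subseteq> monomial_ideal (symbolic_exponents n)"
    proof
      fix f assume f: "f \<in> symbolic_power ?I n"
      have "f \<in> monomial_ideal {e. n \<le> coweight k e}" for k
      proof (rule mem_extended_idealD)
        let ?P = "monomial_ideal {e. 1 \<le> coweight k e} :: 'k poly3 set"
        show prime: "primeideal ?P poly3_ring" by (rule primeideal_coweight)
        have "?P \<in> ?Ass" using prime annihilator_var[of k, where 'k = 'k] by blast
        then show "Fraction_Field.Fract f 1 \<in> extended_ideal ?P (monomial_ideal (power_exponents n))"
          using f unfolding symb by blast
        show "ideal (monomial_ideal {e. n \<le> coweight k e} :: 'k poly3 set) poly3_ring"
          by (rule ideal_monomial_ideal[OF translation_closed_coweight])
        show "monomial_ideal (power_exponents n) \<subseteq> monomial_ideal {e. n \<le> coweight k e}"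
          by (auto simp: monomial_ideal_def power_exponents_def symbolic_exponents_def)
        show "g \<in> monomial_ideal {e. n \<le> coweight k e}"
          if "s \<notin> ?P" "s * g \<in> monomial_ideal {e. n \<le> coweight k e}" for s g
          using mult_in_weight_ideal_cancel[OF coweight_add that] .
      qed
      then show "f \<in> monomial_ideal (symbolic_exponents n)"
        by (auto simp: monomial_ideal_def symbolic_exponents_def)
    qed
    show "monomial_ideal (symbolic_exponents n) \<subseteq> symbolic_power ?I n"
    proof
      fix f :: "'k poly3" assume f: "f \<in> monomial_ideal (symbolic_exponents n)"
      have "Fraction_Field.Fract f 1 \<in> extended_ideal P (monomial_ideal (power_exponents n))"
        if prime: "primeideal P poly3_ring" and P: "P = {r. r * g \<in> ?I}" for P g
      proof -
        interpret P: primeideal P "poly3_ring :: 'k poly3 ring" by (rule prime)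
        have zero: "0 \<in> P" by (rule ideal_typeD(1)[OF P.is_ideal])
        have one: "1 \<notin> P" using P.one_imp_carrier P.I_notcarr by auto
        then have "g \<notin> ?I" by (simp add: P)
        then obtain k where k: "poly3_var k \<notin> P"
          using annihilator_misses_var P by blast
        have "Poly_Mapping.single (Poly_Mapping.single k m) 1 \<notin> P" for m
        proof (induction m)
          case 0
          then show ?case using one by simp
        next
          case (Suc m)
          have "Poly_Mapping.single (Poly_Mapping.single k (Suc m)) 1
              = poly3_var k * (Poly_Mapping.single (Poly_Mapping.single k m) 1 :: 'k poly3)"
            by (simp add: poly3_var_def mult_single flip: single_add)
          then show ?case using P.I_prime[of "poly3_var k"] k Suc by auto
        qed
        moreover have "Poly_Mapping.single (Poly_Mapping.single k n) 1 * f
            \<in> monomial_ideal (power_exponents n)"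
          using f var_power_shift by (auto simp: monomial_ideal_def keys_single_mult)
        ultimately show ?thesis using zero by (intro mem_extended_idealI)
      qed
      then show "f \<in> symbolic_power ?I n" unfolding symb by blast
    qed
  qed
qed

section \<open>Minimal numbers of generators\<close>

lemma poly3_const_simps:
  "poly3_const 1 = (1 :: 'k::field poly3)"
  "poly3_const (a + b) = (poly3_const a + poly3_const b :: 'k::field poly3)"
  "poly3_const (a * b) = (poly3_const a * poly3_const b :: 'k::field poly3)"
  by (simp_all add: poly3_const_def single_add mult_single)

lemma vectorspace_restrict_scalars:
  fixes M :: "('k::field poly3, 'b, 'c) module_scheme"
  assumes "module poly3_ring M"
  shows "vectorspace (ring_of_type_algebra :: 'k ring) (restrict_scalars poly3_const M)"
proof -
  interpret M: module "poly3_ring :: 'k poly3 ring" M by (rule assms)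
  have "module (ring_of_type_algebra :: 'k ring) (restrict_scalars poly3_const M)"
  proof (rule module_criteria)
    show "\<forall>v\<in>carrier (restrict_scalars poly3_const M). \<exists>w\<in>carrier (restrict_scalars poly3_const M).
        v \<oplus>\<^bsub>restrict_scalars poly3_const M\<^esub> w = \<zero>\<^bsub>restrict_scalars poly3_const M\<^esub>"
      using M.M.r_neg by (auto intro!: bexI[of _ "\<ominus>\<^bsub>M\<^esub> _"])
    show "cring (ring_of_type_algebra :: 'k ring)" by (rule cring_from_type_algebra)
  qed (use M.smult_l_distr M.smult_assoc1 M.smult_one
      in \<open>auto simp: poly3_const_simps M.M.a_ac M.smult_r_distr\<close>)
  moreover have "field (ring_of_type_algebra :: 'k ring)" by (rule field_from_type_algebra)
  ultimately show ?thesis by (simp add: vectorspace_def)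
qed

text \<open>
  Coordinates on a module whose common kernel is the product with the maximal ideal descend to
  coordinates on the quotient, which is the vector space whose dimension is counted.
\<close>

lemma min_gens_eq_card_coordinates:
  fixes M :: "('k::field poly3, 'b, 'c) module_scheme" and c :: "'b \<Rightarrow> 'i \<Rightarrow> 'k"
  assumes M: "module poly3_ring M" and fin: "finite B"
    and e: "\<And>b. b \<in> B \<Longrightarrow> e b \<in> carrier M"
    and c_add: "\<And>v w b. v \<in> carrier M \<Longrightarrow> w \<in> carrier M \<Longrightarrow> b \<in> B \<Longrightarrow> c (v \<oplus>\<^bsub>M\<^esub> w) b = c v b + c w b"
    and c_smult: "\<And>a v b. v \<in> carrier M \<Longrightarrow> b \<in> B \<Longrightarrow> c (poly3_const a \<odot>\<^bsub>M\<^esub> v) b = a * c v b"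
    and dual: "\<And>b b'. b \<in> B \<Longrightarrow> b' \<in> B \<Longrightarrow> c (e b) b' = (if b = b' then 1 else 0)"
    and ker: "\<And>v. v \<in> carrier M \<Longrightarrow>
      v \<in> ideal_smult poly3_ring irrelevant_ideal M \<longleftrightarrow> (\<forall>b\<in>B. c v b = 0)"
  shows "min_gens M = card B"
proof -
  interpret M: module "poly3_ring :: 'k poly3 ring" M by (rule M)
  let ?N = "ideal_smult poly3_ring irrelevant_ideal M"
  let ?V = "restrict_scalars poly3_const (module_quot M ?N)"
  have sub: "LinearCombinations.submodule poly3_ring ?N M"
    unfolding ideal_smult_def by (rule M.span_is_submodule) auto
  then interpret N: LinearCombinations.submodule "poly3_ring :: 'k poly3 ring" ?N M .
  interpret V: vectorspace "ring_of_type_algebra :: 'k ring" ?V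
    by (intro vectorspace_restrict_scalars M.module_module_quot sub)
  have "restrict (c (h \<oplus>\<^bsub>M\<^esub> v)) B = restrict (c v) B" if "h \<in> ?N" "v \<in> carrier M" for h v
    using that ker[of h] N.subset by (auto simp: restrict_def fun_eq_iff c_add)
  then obtain c' where c': "\<And>v. v \<in> carrier M \<Longrightarrow> c' (?N +>\<^bsub>M\<^esub> v) = restrict (c v) B"
    using M.factor_through_quot[OF sub, of "\<lambda>v. restrict (c v) B"] by blast
  have add: "(?N +>\<^bsub>M\<^esub> v) \<oplus>\<^bsub>?V\<^esub> (?N +>\<^bsub>M\<^esub> w) = ?N +>\<^bsub>M\<^esub> (v \<oplus>\<^bsub>M\<^esub> w)"
    if "v \<in> carrier M" "w \<in> carrier M" for v w
    using M.add_cosets[OF sub that] by simp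
  have smult: "a \<odot>\<^bsub>?V\<^esub> (?N +>\<^bsub>M\<^esub> v) = ?N +>\<^bsub>M\<^esub> (poly3_const a \<odot>\<^bsub>M\<^esub> v)"
    if "v \<in> carrier M" for a v
    using M.smult_coset[OF sub _ that, of "poly3_const a"] by simp
  have carrier: "carrier ?V = (\<lambda>v. ?N +>\<^bsub>M\<^esub> v) ` carrier M"
    by (simp add: M.carrier_module_quot)
  have "V.dim = card B"
  proof (rule V.dim_eq_card_coordinates[OF fin, where e = "\<lambda>b. ?N +>\<^bsub>M\<^esub> e b" and c = c'])
    show "u = \<zero>\<^bsub>?V\<^esub>" if "u \<in> carrier ?V" "\<And>b. b \<in> B \<Longrightarrow> c' u b = \<zero>\<^bsub>ring_of_type_algebra\<^esub>" for u
    proof -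
      obtain v where v: "v \<in> carrier M" "u = ?N +>\<^bsub>M\<^esub> v" using \<open>u \<in> carrier ?V\<close> carrier by auto
      then have "v \<in> ?N" using ker that(2) c' by simp
      then show ?thesis using M.coset_eq_self_iff[OF sub v(1)] v(2) by simp
    qed
    show "c' (u \<oplus>\<^bsub>?V\<^esub> u') b = c' u b \<oplus>\<^bsub>ring_of_type_algebra\<^esub> c' u' b"
      if "u \<in> carrier ?V" "u' \<in> carrier ?V" "b \<in> B" for u u' b
      using that unfolding carrier by (auto simp: add c' c_add simp del: restrict_scalars_simps(3))
    show "c' (a \<odot>\<^bsub>?V\<^esub> u) b = a \<otimes>\<^bsub>ring_of_type_algebra\<^esub> c' u b"
      if "u \<in> carrier ?V" "b \<in> B" for a u b
      using that unfolding carrier by (auto simp: smult c' c_smult simp del: restrict_scalars_simps(4))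
  qed (use e dual in \<open>auto simp: c' carrier simp del: restrict_scalars_simps(1)\<close>)
  then show ?thesis by (simp add: min_gens_def)
qed

lemma poly3_var_in_irrelevant_ideal: "poly3_var k \<in> (irrelevant_ideal :: 'k::field poly3 set)"
proof -
  interpret R: cring "poly3_ring :: 'k poly3 ring" by (rule cring_from_type_algebra)
  have "\<forall>k. poly3_var k \<in> (irrelevant_ideal :: 'k poly3 set)"
    using R.genideal_self[of "{x_var, y_var, z_var}"] by (simp add: all_3 irrelevant_ideal_def)
  then show ?thesis by blast
qed

lemma irrelevant_ideal_subset:
  "irrelevant_ideal \<subseteq> (monomial_ideal (- {0}) :: 'k::field poly3 set)"
proof -
  interpret R: cring "poly3_ring :: 'k poly3 ring" by (rule cring_from_type_algebra)
  have "d + e \<noteq> 0" if "e \<noteq> 0" for d e :: mon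
    using that by (auto simp: poly_mapping_eq_iff lookup_add fun_eq_iff)
  then have "ideal (monomial_ideal (- {0}) :: 'k poly3 set) poly3_ring"
    by (intro ideal_monomial_ideal) (auto simp: translation_closed_def)
  moreover have "poly3_var k \<in> (monomial_ideal (- {0}) :: 'k poly3 set)" for k
    by (auto simp: monomial_ideal_def poly3_var_def poly_mapping_eq_iff fun_eq_iff lookup_single
        when_def)
  ultimately show ?thesis
    unfolding irrelevant_ideal_def by (intro R.genideal_minimal) auto
qed

lemma mon_nonzeroE:
  fixes e :: mon
  assumes "e \<noteq> 0"
  obtains d i where "e = Poly_Mapping.single i 1 + d"
proof -
  obtain i where i: "Poly_Mapping.lookup e i \<noteq> 0"
    using assms by (auto simp: poly_mapping_eq_iff fun_eq_iff)
  have "Poly_Mapping.lookup (Poly_Mapping.single i 1) j \<le> Poly_Mapping.lookup e j" for j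
    using i by (auto simp: lookup_single when_def)
  then obtain d where "e = d + Poly_Mapping.single i 1" by (rule poly_mapping_nat_leE)
  then show thesis using that by (metis add.commute)
qed

text \<open>
  Minimality is tested against division by single variables only. For a translation closed set \<open>F\<close>
  this amounts to minimality under divisibility.
\<close>

definition minimal_exponents :: "mon set \<Rightarrow> mon set" where
  "minimal_exponents F = {b \<in> F. \<forall>i. \<forall>d\<in>F. b \<noteq> Poly_Mapping.single i 1 + d}"

lemma minimal_exponent_of_mult:
  fixes a f :: "'k::field poly3"
  assumes F: "translation_closed F" and f: "f \<in> monomial_ideal F"
    and b: "b \<in> minimal_exponents F" "b \<in> Poly_Mapping.keys (a * f)"
  shows "0 \<in> Poly_Mapping.keys a" and "b \<in> Poly_Mapping.keys f"
proof -
  obtain p q where pq: "p \<in> Poly_Mapping.keys a" "q \<in> Poly_Mapping.keys f" "b = p + q"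
    using b(2) by (rule keys_mult_obtain)
  have "p = 0"
  proof (rule ccontr)
    assume "p \<noteq> 0"
    then obtain d i where "p = Poly_Mapping.single i 1 + d" by (rule mon_nonzeroE)
    then have "b = Poly_Mapping.single i 1 + (d + q)" using pq by (simp add: add.assoc)
    moreover have "d + q \<in> F"
      using F f pq(2) by (auto simp: monomial_ideal_def translation_closed_def)
    ultimately show False using b(1) unfolding minimal_exponents_def by blast
  qed
  then show "0 \<in> Poly_Mapping.keys a" "b \<in> Poly_Mapping.keys f" using pq by simp_all
qed

text \<open>
  The coefficients at the minimal exponents of \<open>F\<close> outside \<open>E\<close> serve as coordinates on the quotient. They
  vanish on products with the maximal ideal by minimality of the exponents. Conversely, if they
  vanish on \<open>f\<close>, every term of \<open>f\<close> either lies in the denominator or is a variable times a monomial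
  of the numerator.
\<close>

lemma min_gens_monomial_quotient:
  assumes E: "translation_closed E" and F: "translation_closed F" and EF: "E \<subseteq> F"
    and fin: "finite (minimal_exponents F - E)"
  shows "min_gens (module_quot (ideal_module poly3_ring (monomial_ideal F))
      (monomial_ideal E :: 'k::field poly3 set)) = card (minimal_exponents F - E)"
proof -
  let ?R = "poly3_ring :: 'k poly3 ring"
  let ?S = "monomial_ideal F :: 'k poly3 set" and ?N = "monomial_ideal E :: 'k poly3 set"
  let ?L = "ideal_module ?R ?S"
  let ?M = "module_quot ?L ?N"
  let ?B = "minimal_exponents F - E"
  define p where "p f = ?N +>\<^bsub>?L\<^esub> f" for f
  have S: "ideal ?S ?R" and N: "ideal ?N ?R" by (intro ideal_monomial_ideal E F)+
  have NS: "?N \<subseteq> ?S" using EF by (auto simp: monomial_ideal_def)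
  interpret L: module ?R ?L by (rule module_ideal_module[OF S])
  have sub: "LinearCombinations.submodule ?R ?N ?L" by (rule submodule_ideal_module[OF S N NS])
  interpret M: module ?R ?M by (rule L.module_module_quot[OF sub])
  have carrier: "carrier ?M = p ` ?S" by (simp add: L.carrier_module_quot p_def)
  have add: "p f \<oplus>\<^bsub>?M\<^esub> p g = p (f + g)" if "f \<in> ?S" "g \<in> ?S" for f g
    using L.add_cosets[OF sub, of f g] that by (simp add: p_def)
  have smult: "a \<odot>\<^bsub>?M\<^esub> p f = p (a * f)" if "f \<in> ?S" for a f
    using L.smult_coset[OF sub, of a f] that by (simp add: p_def)
  have p_zero: "p f = \<zero>\<^bsub>?M\<^esub>" if "f \<in> ?N" for f
    using L.coset_eq_self_iff[OF sub, of f] that NS by (auto simp: p_def)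
  define G where "G = {a \<odot>\<^bsub>?M\<^esub> x | a x. a \<in> irrelevant_ideal \<and> x \<in> carrier ?M}"
  have G: "G = {p (a * f) | a f. a \<in> irrelevant_ideal \<and> f \<in> ?S}"
  proof -
    have "G = {a \<odot>\<^bsub>?M\<^esub> p f | a f. a \<in> irrelevant_ideal \<and> f \<in> ?S}"
      unfolding G_def carrier by blast
    also have "\<dots> = {p (a * f) | a f. a \<in> irrelevant_ideal \<and> f \<in> ?S}"
      by (intro Collect_cong iff_exI) (metis smult)
    finally show ?thesis .
  qed
  have mM: "ideal_smult ?R irrelevant_ideal ?M = M.span G"
    by (simp add: ideal_smult_def G_def)
  have XM: "G \<subseteq> carrier ?M"
    unfolding G carrier using ideal_typeD(3)[OF S] by auto
  have mM_sub: "LinearCombinations.submodule ?R (M.span G) ?M" by (rule M.span_is_submodule[OF XM])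
  interpret mM: LinearCombinations.submodule ?R "M.span G" ?M by (rule mM_sub)
  have "restrict (Poly_Mapping.lookup (h + f)) ?B = restrict (Poly_Mapping.lookup f) ?B"
    if "h \<in> ?N" for h f
    using that by (auto simp: restrict_def fun_eq_iff lookup_add monomial_ideal_def in_keys_iff)
  then obtain c where c: "\<And>f. f \<in> ?S \<Longrightarrow> c (p f) = restrict (Poly_Mapping.lookup f) ?B"
    using L.factor_through_quot[OF sub, of "\<lambda>f. restrict (Poly_Mapping.lookup f) ?B"]
    by (auto simp: p_def)
  \<comment> \<open>The coordinates of a class do not depend on its representative, as \<open>?B\<close> is disjoint from \<open>E\<close>; so the
    classes with vanishing coordinates form the submodule \<open>?T\<close>, to be identified with the span.\<close>
  let ?T = "{p f | f. f \<in> ?S \<and> (\<forall>b\<in>?B. Poly_Mapping.lookup f b = 0)}"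
  have T: "LinearCombinations.submodule ?R ?T ?M"
  proof (rule LinearCombinations.submodule.intro)
    show "module ?R ?M" by (rule M.module_axioms)
    show "?T \<subseteq> carrier ?M" using carrier by auto
    show "\<zero>\<^bsub>?M\<^esub> \<in> ?T"
      using p_zero[OF zero_in_monomial_ideal] by (force intro: zero_in_monomial_ideal)
    show "v \<oplus>\<^bsub>?M\<^esub> w \<in> ?T" if vw: "v \<in> ?T" "w \<in> ?T" for v w
    proof -
      obtain f g where "f \<in> ?S" "g \<in> ?S" "v = p f" "w = p g"
        "\<forall>b\<in>?B. Poly_Mapping.lookup f b = 0" "\<forall>b\<in>?B. Poly_Mapping.lookup g b = 0"
        using vw by blast
      then have "v \<oplus>\<^bsub>?M\<^esub> w = p (f + g)" "f + g \<in> ?S" "\<forall>b\<in>?B. Poly_Mapping.lookup (f + g) b = 0"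
        using add add_in_monomial_ideal by (auto simp: lookup_add)
      then show ?thesis by blast
    qed
    show "a \<odot>\<^bsub>?M\<^esub> v \<in> ?T" if v: "v \<in> ?T" for a v
    proof -
      obtain f where f: "f \<in> ?S" "v = p f" "\<forall>b\<in>?B. Poly_Mapping.lookup f b = 0"
        using v by blast
      have "Poly_Mapping.lookup (a * f) b = 0" if "b \<in> ?B" for b
        using that f(3) minimal_exponent_of_mult(2)[OF F f(1), of b a] by (auto simp: in_keys_iff)
      moreover have "a * f \<in> ?S" by (rule mult_in_monomial_ideal[OF F f(1)])
      ultimately show ?thesis unfolding f(2) smult[OF f(1)] by blast
    qed
  qed
  have span_T: "M.span G \<subseteq> ?T"
  proof (rule M.span_is_subset[OF _ T])
    show "G \<subseteq> ?T"
    proof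
      fix v assume "v \<in> G"
      then obtain a f where v: "v = p (a * f)" "a \<in> irrelevant_ideal" "f \<in> ?S" unfolding G by blast
      have "0 \<notin> Poly_Mapping.keys a"
        using v(2) irrelevant_ideal_subset by (auto simp: monomial_ideal_def)
      then have "Poly_Mapping.lookup (a * f) b = 0" if "b \<in> ?B" for b
        using that minimal_exponent_of_mult(1)[OF F v(3), of b a] by (auto simp: in_keys_iff)
      moreover have "a * f \<in> ?S" by (rule mult_in_monomial_ideal[OF F v(3)])
      ultimately show "v \<in> ?T" using v(1) by blast
    qed
  qed
  have T_span: "p f \<in> M.span G" if f: "f \<in> ?S" "\<forall>b\<in>?B. Poly_Mapping.lookup f b = 0" for f
  proof -
    have "f \<in> {f \<in> ?S. p f \<in> M.span G}"
    proof (rule closed_under_terms)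
      show "0 \<in> {f \<in> ?S. p f \<in> M.span G}"
        using p_zero[OF zero_in_monomial_ideal] mM.zero_closed zero_in_monomial_ideal by auto
      show "g + h \<in> {f \<in> ?S. p f \<in> M.span G}"
        if "g \<in> {f \<in> ?S. p f \<in> M.span G}" "h \<in> {f \<in> ?S. p f \<in> M.span G}" for g h
        using that mM.m_closed[of "p g" "p h"] add[of g h] add_in_monomial_ideal[of g F h] by auto
      fix e assume e: "e \<in> Poly_Mapping.keys f"
      let ?t = "Poly_Mapping.single e (Poly_Mapping.lookup f e)"
      have eF: "e \<in> F" using e f(1) by (auto simp: monomial_ideal_def)
      have "p ?t \<in> M.span G"
      proof (cases "e \<in> E")
        case True
        then have "p ?t = \<zero>\<^bsub>?M\<^esub>" by (intro p_zero single_in_monomial_ideal)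
        then show ?thesis using mM.zero_closed by simp
      next
        case False
        have "e \<notin> ?B" using e f(2) by (auto simp: in_keys_iff)
        then obtain i d where d: "d \<in> F" "e = Poly_Mapping.single i 1 + d"
          using False eF unfolding minimal_exponents_def by blast
        have "p (poly3_var i * Poly_Mapping.single d (Poly_Mapping.lookup f e)) \<in> G"
          unfolding G using poly3_var_in_irrelevant_ideal single_in_monomial_ideal[OF d(1)] by blast
        also have "poly3_var i * Poly_Mapping.single d (Poly_Mapping.lookup f e) = ?t"
          using d(2) by (simp add: poly3_var_def mult_single)
        finally show ?thesis using M.in_own_span[OF XM] by blast
      qed
      then show "?t \<in> {f \<in> ?S. p f \<in> M.span G}" using single_in_monomial_ideal[OF eF] by simp
    qed
    then show ?thesis by simp
  qed
  show ?thesis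
  proof (rule min_gens_eq_card_coordinates[OF M.module_axioms fin, where c = c
        and e = "\<lambda>b. p (Poly_Mapping.single b 1)"])
    have single_S: "Poly_Mapping.single b 1 \<in> ?S" if "b \<in> ?B" for b
      using that by (intro single_in_monomial_ideal) (auto simp: minimal_exponents_def)
    show "p (Poly_Mapping.single b 1) \<in> carrier ?M" if "b \<in> ?B" for b
      using single_S[OF that] carrier by blast
    show "c (p (Poly_Mapping.single b 1)) b' = (if b = b' then 1 else 0)"
      if "b \<in> ?B" "b' \<in> ?B" for b b'
      using c[OF single_S[OF that(1)]] that(2) by (simp add: lookup_single when_def)
    show "c (v \<oplus>\<^bsub>?M\<^esub> w) b = c v b + c w b"
      if vw: "v \<in> carrier ?M" "w \<in> carrier ?M" and b: "b \<in> ?B" for v w b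
    proof -
      obtain f where f: "v = p f" "f \<in> ?S" using vw(1) unfolding carrier by (rule imageE)
      obtain g where g: "w = p g" "g \<in> ?S" using vw(2) unfolding carrier by (rule imageE)
      show ?thesis
        unfolding f(1) g(1) add[OF f(2) g(2)] c[OF f(2)] c[OF g(2)]
          c[OF add_in_monomial_ideal[OF f(2) g(2)]]
        using b by (simp add: lookup_add)
    qed
    show "c (poly3_const a \<odot>\<^bsub>?M\<^esub> v) b = a * c v b"
      if v: "v \<in> carrier ?M" and b: "b \<in> ?B" for a v b
    proof -
      obtain f where f: "v = p f" "f \<in> ?S" using v unfolding carrier by (rule imageE)
      show ?thesis
        unfolding f(1) smult[OF f(2)] c[OF f(2)] c[OF mult_in_monomial_ideal[OF F f(2)]]
        using b lookup_single_mult[of 0 a f b] by (simp add: poly3_const_def)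
    qed
    show "v \<in> ideal_smult ?R irrelevant_ideal ?M \<longleftrightarrow> (\<forall>b\<in>?B. c v b = 0)"
      if v: "v \<in> carrier ?M" for v
    proof
      assume "v \<in> ideal_smult ?R irrelevant_ideal ?M"
      then obtain f where "f \<in> ?S" "v = p f" "\<forall>b\<in>?B. Poly_Mapping.lookup f b = 0"
        using span_T mM by blast
      then show "\<forall>b\<in>?B. c v b = 0" using c by simp
    next
      assume *: "\<forall>b\<in>?B. c v b = 0"
      obtain f where f: "v = p f" "f \<in> ?S" using v unfolding carrier by (rule imageE)
      then have "\<forall>b\<in>?B. Poly_Mapping.lookup f b = 0" using * c[OF f(2)] by simp
      then show "v \<in> ideal_smult ?R irrelevant_ideal ?M" unfolding mM f(1) by (rule T_span[OF f(2)])
    qed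
  qed
qed

section \<open>Counting\<close>

lemma coweight_single: "coweight k (Poly_Mapping.single i c) = (if k = i then 0 else c)"
proof -
  have "coweight k (Poly_Mapping.single i c) = (\<Sum>j\<in>-{k}. if i = j then c else 0)"
    by (simp add: coweight_def lookup_single when_def)
  then show ?thesis by auto
qed

text \<open>
  A variable with positive exponent can be divided out exactly if each of the coweights to
  which it contributes has slack.
\<close>

lemma minimal_symbolic_exponents_iff:
  "e \<in> minimal_exponents (symbolic_exponents n) \<longleftrightarrow> e \<in> symbolic_exponents n \<and>
    (\<forall>i. Poly_Mapping.lookup e i = 0 \<or> (\<exists>k\<in>-{i}. coweight k e = n))"
    (is "?lhs \<longleftrightarrow> ?sym \<and> ?tight")
proof
  assume lhs: ?lhs
  then have sym: ?sym by (simp add: minimal_exponents_def)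
  have "\<exists>k\<in>-{i}. coweight k e = n" if i: "Poly_Mapping.lookup e i \<noteq> 0" for i
  proof (rule ccontr)
    assume *: "\<not> (\<exists>k\<in>-{i}. coweight k e = n)"
    have "Poly_Mapping.lookup (Poly_Mapping.single i 1) j \<le> Poly_Mapping.lookup e j" for j
      using i by (auto simp: lookup_single when_def)
    then obtain d where d: "e = d + Poly_Mapping.single i 1" by (rule poly_mapping_nat_leE)
    have "n \<le> coweight k d" for k
    proof -
      have "n \<le> coweight k e" "k \<noteq> i \<longrightarrow> coweight k e \<noteq> n"
        using sym * by (auto simp: symbolic_exponents_def)
      then show ?thesis by (auto simp: d coweight_add coweight_single split: if_splits)
    qed
    then have "d \<in> symbolic_exponents n" by (simp add: symbolic_exponents_def)
    moreover have "e = Poly_Mapping.single i 1 + d" unfolding d by (rule add.commute)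
    ultimately show False using lhs unfolding minimal_exponents_def by blast
  qed
  with sym show "?sym \<and> ?tight" by blast
next
  assume *: "?sym \<and> ?tight"
  have "e \<noteq> Poly_Mapping.single i 1 + d" if d: "d \<in> symbolic_exponents n" for i d
  proof
    assume e: "e = Poly_Mapping.single i 1 + d"
    then have "Poly_Mapping.lookup e i \<noteq> 0" by (simp add: lookup_add)
    then have "\<exists>k\<in>-{i}. coweight k e = n"
      using *[THEN conjunct2, THEN spec, of i] by simp
    then obtain k where "k \<noteq> i" "coweight k e = n" by auto
    then have "coweight k d < n" by (auto simp: e coweight_add coweight_single)
    then show False using d by (auto simp: symbolic_exponents_def not_less[symmetric])
  qed
  then show ?lhs using * unfolding minimal_exponents_def by blast
qed

text \<open>
  Below total degree \<open>2 * n\<close> all three exponents are positive, so that each of them must occur in a sum equal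
  to \<open>n\<close>. Hence two of the three sums of pairs equal \<open>n\<close>, which makes two exponents equal.
\<close>

lemma tight_triple_iff:
  fixes a b c n :: nat
  assumes "n \<ge> 1"
  shows "(n \<le> b + c \<and> n \<le> a + c \<and> n \<le> a + b \<and> a + b + c < 2 * n \<and>
      (a = 0 \<or> a + c = n \<or> a + b = n) \<and> (b = 0 \<or> b + c = n \<or> a + b = n) \<and>
      (c = 0 \<or> b + c = n \<or> a + c = n)) \<longleftrightarrow>
    (1 \<le> a \<and> 2 * a < n \<and> b = n - a \<and> c = n - a) \<or> (1 \<le> b \<and> 2 * b < n \<and> a = n - b \<and> c = n - b) \<or>
    (1 \<le> c \<and> 2 * c < n \<and> a = n - c \<and> b = n - c) \<or> (2 * a = n \<and> b = a \<and> c = a)"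
    (is "?lhs \<longleftrightarrow> ?rhs")
proof
  assume ?lhs
  then have *: "n \<le> b + c" "n \<le> a + c" "n \<le> a + b" "a + b + c < 2 * n"
    "a = 0 \<or> a + c = n \<or> a + b = n" "b = 0 \<or> b + c = n \<or> a + b = n" "c = 0 \<or> b + c = n \<or> a + c = n"
    by blast+
  have "a \<ge> 1" "b \<ge> 1" "c \<ge> 1" using *(1-4) by linarith+
  then consider "a + c = n" "a + b = n" | "b + c = n" "a + b = n" | "b + c = n" "a + c = n"
    using *(5-7) by fastforce
  then show ?rhs
  proof cases
    case 1
    then have "b = n - a" "c = n - a" "2 * a \<le> n" using *(1) by linarith+
    then show ?thesis using \<open>a \<ge> 1\<close> by (cases "2 * a = n") auto
  next
    case 2
    then have "a = n - b" "c = n - b" "2 * b \<le> n" using *(2) by linarith+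
    then show ?thesis using \<open>b \<ge> 1\<close> by (cases "2 * b = n") auto
  next
    case 3
    then have "a = n - c" "b = n - c" "2 * c \<le> n" using *(3) by linarith+
    then show ?thesis using \<open>c \<ge> 1\<close> by (cases "2 * c = n") auto
  qed
next
  assume ?rhs
  then show ?lhs using assms by (elim disjE conjE) auto
qed

definition tight_triples :: "nat \<Rightarrow> (nat \<times> nat \<times> nat) set" where
  "tight_triples n =
    (let A = {t. 1 \<le> t \<and> 2 * t < n} in
      (\<lambda>t. (t, n - t, n - t)) ` A \<union> (\<lambda>t. (n - t, t, n - t)) ` A \<union> (\<lambda>t. (n - t, n - t, t)) ` A \<union>
      (if even n then {(n div 2, n div 2, n div 2)} else {}))"

lemma mem_tight_triples_iff:
  "(a, b, c) \<in> tight_triples n \<longleftrightarrow>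
    (1 \<le> a \<and> 2 * a < n \<and> b = n - a \<and> c = n - a) \<or> (1 \<le> b \<and> 2 * b < n \<and> a = n - b \<and> c = n - b) \<or>
    (1 \<le> c \<and> 2 * c < n \<and> a = n - c \<and> b = n - c) \<or> (2 * a = n \<and> b = a \<and> c = a)"
proof -
  let ?A = "{t. 1 \<le> t \<and> 2 * t < n}"
  have "(a, b, c) \<in> (\<lambda>t. (t, n - t, n - t)) ` ?A \<longleftrightarrow> 1 \<le> a \<and> 2 * a < n \<and> b = n - a \<and> c = n - a"
    "(a, b, c) \<in> (\<lambda>t. (n - t, t, n - t)) ` ?A \<longleftrightarrow> 1 \<le> b \<and> 2 * b < n \<and> a = n - b \<and> c = n - b"
    "(a, b, c) \<in> (\<lambda>t. (n - t, n - t, t)) ` ?A \<longleftrightarrow> 1 \<le> c \<and> 2 * c < n \<and> a = n - c \<and> b = n - c"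
    "(a, b, c) \<in> (if even n then {(n div 2, n div 2, n div 2)} else {}) \<longleftrightarrow> 2 * a = n \<and> b = a \<and> c = a"
    by auto
  then show ?thesis unfolding tight_triples_def Let_def Un_iff by simp
qed

lemma card_tight_triples:
  assumes "n \<ge> 1"
  shows "finite (tight_triples n)"
    and "2 * card (tight_triples n) = (if even n then 3 * n - 4 else 3 * n - 3)"
proof -
  define A where "A = {t. 1 \<le> t \<and> 2 * t < n}"
  let ?S1 = "(\<lambda>t. (t, n - t, n - t)) ` A" and ?S2 = "(\<lambda>t. (n - t, t, n - t)) ` A"
  let ?S3 = "(\<lambda>t. (n - t, n - t, t)) ` A"
  let ?S4 = "if even n then {(n div 2, n div 2, n div 2)} else {}"
  have eq: "tight_triples n = ?S1 \<union> ?S2 \<union> ?S3 \<union> ?S4"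
    by (simp only: tight_triples_def Let_def A_def)
  have A: "t < n - t" "n div 2 < n - t" if "t \<in> A" for t using that by (auto simp: A_def)
  have A_eq: "A = {1..<(n + 1) div 2}" by (auto simp: A_def)
  have fin: "finite A" by (simp add: A_eq)
  show "finite (tight_triples n)" using fin by (simp add: eq)
  have cards: "card ?S1 = card A" "card ?S2 = card A" "card ?S3 = card A"
    by (rule card_image, auto intro: inj_onI)+
  have 12: "?S1 \<inter> ?S2 = {}" using A by fastforce
  have 123: "(?S1 \<union> ?S2) \<inter> ?S3 = {}" using A by fastforce
  have 1234: "(?S1 \<union> ?S2 \<union> ?S3) \<inter> ?S4 = {}" using A(2) by (auto dest: less_imp_neq)
  have "card (tight_triples n) = 3 * card A + card ?S4"
    unfolding eq using 12 123 1234 fin cards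
    by (subst card_Un_disjoint, simp, simp, simp)+ simp
  also have "card A = (n + 1) div 2 - 1" by (simp add: A_eq)
  finally show "2 * card (tight_triples n) = (if even n then 3 * n - 4 else 3 * n - 3)"
    using assms(1) by (auto elim!: evenE oddE)
qed

lemma card_minimal_exponents:
  assumes "n \<ge> 1"
  shows "finite (minimal_exponents (symbolic_exponents n) - power_exponents n)"
    and "2 * card (minimal_exponents (symbolic_exponents n) - power_exponents n)
      = (if even n then 3 * n - 4 else 3 * n - 3)"
proof -
  let ?B = "minimal_exponents (symbolic_exponents n) - power_exponents n"
  define T where "T e = (Poly_Mapping.lookup e 1, Poly_Mapping.lookup e 2, Poly_Mapping.lookup e 3)"
    for e :: mon
  have inj: "inj T"
  proof (rule injI)
    fix d e assume "T d = T e"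
    then have "\<forall>i. Poly_Mapping.lookup d i = Poly_Mapping.lookup e i"
      unfolding all_3 by (simp add: T_def)
    then show "d = e" by (auto intro: poly_mapping_eqI)
  qed
  have B_iff: "e \<in> ?B \<longleftrightarrow> T e \<in> tight_triples n" for e
  proof -
    have eqs: "(\<exists>k\<in>{i, j}. coweight k e = n) \<longleftrightarrow> coweight i e = n \<or> coweight j e = n" for i j
      by simp
    show ?thesis
      unfolding T_def mem_tight_triples_iff tight_triple_iff[OF assms, symmetric]
      unfolding Diff_iff minimal_symbolic_exponents_iff mem_power_exponents_iff
        mem_symbolic_exponents_iff all_3 compl_3 eqs coweight_simps
        not_le[symmetric]
      by argo
  qed
  have "\<exists>e. T e = s" for s
  proof (cases s)
    case (fields a b c)
    then show ?thesis
      by (intro exI[of _ "Poly_Mapping.single 1 a + Poly_Mapping.single 2 b + Poly_Mapping.single 3 c"])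
        (simp add: T_def lookup_add lookup_single when_def)
  qed
  then have "surj T" by (metis surjI)
  moreover have "?B = T -` tight_triples n" using B_iff by blast
  ultimately have "T ` ?B = tight_triples n" by (metis surj_image_vimage_eq)
  then have bij: "bij_betw T ?B (tight_triples n)"
    using inj by (auto simp: bij_betw_def intro: inj_on_subset)
  show "finite ?B"
    using bij_betw_finite[OF bij] card_tight_triples(1)[OF assms] by simp
  show "2 * card ?B = (if even n then 3 * n - 4 else 3 * n - 3)"
    using bij_betw_same_card[OF bij] card_tight_triples(2)[OF assms] by simp
qed

theorem mainTheorem4:
  fixes I :: "'k::field poly3 set" and n :: nat
  assumes "I = Idl\<^bsub>poly3_ring\<^esub> {x_var * y_var, x_var * z_var, y_var * z_var}"
    and "n \<ge> 1"
  shows "real (sdef I n) =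
    (if n mod 2 = 0 then 3 / 2 * real n - 2 else 3 / 2 * real n - 3 / 2)"
proof -
  have I: "I = monomial_ideal (power_exponents 1)"
    using assms(1) monomial_ideal_var_pairs by simp
  have sdef: "sdef I n = card (minimal_exponents (symbolic_exponents n) - power_exponents n)"
    unfolding I sdef_def symbolic_power_eq ideal_power_eq
    by (intro min_gens_monomial_quotient translation_closed_power_exponents
        translation_closed_symbolic_exponents card_minimal_exponents(1) assms(2))
      (auto simp: power_exponents_def)
  have "2 * sdef I n = (if even n then 3 * n - 4 else 3 * n - 3)"
    unfolding sdef by (rule card_minimal_exponents(2)[OF assms(2)])
  moreover have "even n \<Longrightarrow> 2 \<le> n" using assms(2) by (auto elim: evenE)
  ultimately have "real (2 * sdef I n) = (if even n then 3 * real n - 4 else 3 * real n - 3)"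
    using assms(2) by (auto simp: of_nat_diff)
  then show ?thesis by (auto simp: even_iff_mod_2_eq_zero field_simps)
qed

end
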